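(* Let $\mathcal{H}$ be a separable Hilbert space, let $B,C,D$ be bounded linear operators on $\mathcal{H}$ with $B,C$ symmetric and nonnegative and $B$ nuclear, and let $\alpha$ be a number. Consider the system of equations and initial conditions $$\begin{cases}s'=-\tfrac12 s\cdot\operatorname{tr}(CQ)+\alpha s,\\ P'=R^*CR,\\ Q'=B-QCQ+D^*Q+QD,\\ R'=-QCR+D^*R,\end{cases}\qquad\begin{cases}s(0)=1,\\ P(0)=0,\\ Q(0)=0,\\ R(0)=I\end{cases}$$ for functions $s:\mathbb{R}_+\to\mathbb{C}$ and $P,Q,R:\mathbb{R}_+\to L(\mathcal{H},\mathcal{H})$. If $D=0$, then the solution of this system is $$s(t)=e^{\alpha t}\cdot{\det}^{-1/2}\bigl(\cosh(t\sqrt{CB})\bigr),\qquad P(t)=C\bigl(\tanh(t\sqrt{CB})\bigr)/\sqrt{CB},$$ $$Q(t)=\bigl(\tanh(t\sqrt{CB})/\sqrt{CB}\bigr)B,\qquad R(t)=\cosh^{-1}(t\sqrt{CB}).$$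
   Context: $\mathbb{R}_+=[0,\infty)$; $L(\mathcal{H},\mathcal{H})$ is the space of bounded linear operators on $\mathcal{H}$; $I$ is the unit (identity) operator; $\operatorname{tr}$ is the trace. Even functions of $\sqrt{CB}$ are defined using Maclaurin series, which, due to parity, contain only integer powers of the operator $CB$. Here $\cosh^{-1}(t\sqrt{CB})$ denotes the inverse operator of $\cosh(t\sqrt{CB})$, and ${\det}^{-1/2}(\cdot)=(\det(\cdot))^{-1/2}$, with $\det$ the determinant of an operator of the form identity plus nuclear.
   Formalization: In P, Q and R the operator √(CB) is replaced by √(BC): as printed these formulas fail when B and C do not commute (e.g. B=diag(1,0), C the all-ones 2×2 matrix). The formula for s is unchanged; for commuting B, C the statement is the printed one. *)

theory Defs
  imports "HOL-Analysis.Analysis"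
begin

(* Hilbert spaces over K = R or K = C, treated uniformly: the scalar field is a subfield of the
   complex numbers, and scl is only constrained for scalars in K. The inner product is
   conjugate-linear in its first argument and induces the norm of the Banach space 'a.
   The two lemmas below give the prototypes. *)
locale hilbert_space =
  fixes K :: "complex set"
    and scl :: "complex \<Rightarrow> 'a::banach \<Rightarrow> 'a"
    and ip :: "'a \<Rightarrow> 'a \<Rightarrow> complex"
  assumes scalars: "K = \<real> \<or> K = UNIV"
    and scl_of_real: "scl (of_real r) x = r *\<^sub>R x"
    and scl_add_left: "c \<in> K \<Longrightarrow> d \<in> K \<Longrightarrow> scl (c + d) x = scl c x + scl d x"
    and scl_add_right: "c \<in> K \<Longrightarrow> scl c (x + y) = scl c x + scl c y"
    and scl_scl: "c \<in> K \<Longrightarrow> d \<in> K \<Longrightarrow> scl c (scl d x) = scl (c * d) x"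
    and ip_in_scalars: "ip x y \<in> K"
    and ip_add_right: "ip x (y + z) = ip x y + ip x z"
    and ip_scl_right: "c \<in> K \<Longrightarrow> ip x (scl c y) = c * ip x y"
    and ip_cnj: "ip y x = cnj (ip x y)"
    and ip_self: "ip x x = of_real ((norm x)\<^sup>2)"

lemma hilbert_space_real:
  "hilbert_space \<real> (\<lambda>c x. Re c *\<^sub>R x) (\<lambda>x y :: 'a::{real_inner, banach}. of_real (inner x y))"
  by unfold_locales
    (auto simp: scaleR_add_left scaleR_add_right inner_add_right inner_commute
      dot_square_norm elim!: Reals_cases)

lemma hilbert_space_complex:
  "hilbert_space UNIV (*) (\<lambda>x y :: complex. cnj x * y)"
  by unfold_locales
    (auto simp: scaleR_conv_of_real algebra_simps complex_norm_square simp del: of_real_power)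

type_synonym 'a operator = "'a \<Rightarrow>\<^sub>L 'a"

(* blinfun operators are only real-linear and continuous; a bounded operator on the K-Hilbert
   space is one that also commutes with the scalars of K. *)
definition linear_over :: "complex set \<Rightarrow> (complex \<Rightarrow> 'a \<Rightarrow> 'a) \<Rightarrow> 'a::real_normed_vector operator \<Rightarrow> bool"
  where "linear_over K scl T \<longleftrightarrow> (\<forall>c\<in>K. \<forall>x. T (scl c x) = scl c (T x))"

definition symmetric_op :: "('a \<Rightarrow> 'a \<Rightarrow> complex) \<Rightarrow> 'a::real_normed_vector operator \<Rightarrow> bool"
  where "symmetric_op ip T \<longleftrightarrow> (\<forall>x y. ip (T x) y = ip x (T y))"

definition nonneg_op :: "('a \<Rightarrow> 'a \<Rightarrow> complex) \<Rightarrow> 'a::real_normed_vector operator \<Rightarrow> bool"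
  where "nonneg_op ip T \<longleftrightarrow> (\<forall>x. ip x (T x) \<in> \<real>\<^sub>\<ge>\<^sub>0)"

definition nuclear_op ::
  "(complex \<Rightarrow> 'a \<Rightarrow> 'a) \<Rightarrow> ('a \<Rightarrow> 'a \<Rightarrow> complex) \<Rightarrow> 'a::real_normed_vector operator \<Rightarrow> bool"
  where "nuclear_op scl ip T \<longleftrightarrow>
    (\<exists>a b. summable (\<lambda>n::nat. norm (a n) * norm (b n)) \<and>
           (\<forall>x. (\<lambda>n. scl (ip (a n) x) (b n)) sums T x))"

definition adjoint_op :: "('a \<Rightarrow> 'a \<Rightarrow> complex) \<Rightarrow> 'a::real_normed_vector operator \<Rightarrow> 'a operator"
  where "adjoint_op ip T = (THE S :: 'a operator. \<forall>x y. ip (T x) y = ip x (S y))"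

definition orthonormal_basis :: "('a \<Rightarrow> 'a \<Rightarrow> complex) \<Rightarrow> 'a::real_normed_vector set \<Rightarrow> bool"
  where "orthonormal_basis ip E \<longleftrightarrow>
    (\<forall>e\<in>E. \<forall>f\<in>E. ip e f = (if e = f then 1 else 0)) \<and>
    (\<forall>x. (\<forall>e\<in>E. ip e x = 0) \<longrightarrow> x = 0)"

definition trace_op :: "('a \<Rightarrow> 'a \<Rightarrow> complex) \<Rightarrow> 'a::real_normed_vector operator \<Rightarrow> complex"
  where "trace_op ip T =
    (THE \<tau>. \<forall>E. orthonormal_basis ip E \<longrightarrow> ((\<lambda>e. ip e (T e)) has_sum \<tau>) E)"

(* Determinant of an operator T of the form identity plus nuclear: the limit, along the finite
   subsets F of an orthonormal basis, of the determinants (Leibniz formula) of the matrices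
   (ip e (T f)), e, f \<in> F, of T compressed to the span of F. *)
definition det_op :: "('a \<Rightarrow> 'a \<Rightarrow> complex) \<Rightarrow> 'a::real_normed_vector operator \<Rightarrow> complex"
  where "det_op ip T =
    (THE \<delta>. \<forall>E. orthonormal_basis ip E \<longrightarrow>
       ((\<lambda>F. \<Sum>p | p permutes F. of_int (sign p) * (\<Prod>e\<in>F. ip e (T (p e)))) \<longlongrightarrow> \<delta>)
         (finite_subsets_at_top E))"

definition invertible_op :: "'a::real_normed_vector operator \<Rightarrow> bool"
  where "invertible_op T \<longleftrightarrow> (\<exists>S. T o\<^sub>L S = id_blinfun \<and> S o\<^sub>L T = id_blinfun)"

definition inverse_op :: "'a::real_normed_vector operator \<Rightarrow> 'a operator"
  where "inverse_op T = (THE S :: 'a operator. T o\<^sub>L S = id_blinfun \<and> S o\<^sub>L T = id_blinfun)"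

definition power_op :: "'a::real_normed_vector operator \<Rightarrow> nat \<Rightarrow> 'a operator"
  where "power_op A n = (((o\<^sub>L) A) ^^ n) id_blinfun"

(* cosh (t \<surd>A) and (sinh (t \<surd>A)) / \<surd>A as Maclaurin series in the operator A; no square root
   of A is taken. *)
definition cosh_sqrt :: "real \<Rightarrow> 'a::banach operator \<Rightarrow> 'a operator"
  where "cosh_sqrt t A = (\<Sum>n. (t ^ (2 * n) / fact (2 * n)) *\<^sub>R power_op A n)"

definition sinh_sqrt_div_sqrt :: "real \<Rightarrow> 'a::banach operator \<Rightarrow> 'a operator"
  where "sinh_sqrt_div_sqrt t A = (\<Sum>n. (t ^ (2 * n + 1) / fact (2 * n + 1)) *\<^sub>R power_op A n)"

(* (tanh (t \<surd>A)) / \<surd>A. The Maclaurin series of tanh has a finite radius of convergence, so for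
   large t the quotient of the two entire functions is the only meaningful reading. *)
definition tanh_sqrt_div_sqrt :: "real \<Rightarrow> 'a::banach operator \<Rightarrow> 'a operator"
  where "tanh_sqrt_div_sqrt t A = sinh_sqrt_div_sqrt t A o\<^sub>L inverse_op (cosh_sqrt t A)"

(* Values at negative times are irrelevant; derivatives are one-sided at 0, and those of
   P, Q, R are taken in operator norm. Nuclearity of C Q(t) makes its trace meaningful.
   Order of factors for D = 0: Q' = B - Q C Q gives Q(t) = t B - (t^3 / 3) B C B + ..., so with
   Q = f B, P = C f the function f(t) = (tanh (t \<surd>A)) / \<surd>A must be taken at A = B C (and not
   C B, unless B and C commute); det (cosh (t \<surd>A)) is the same for both products. *)
definition solves_system ::
  "complex set \<Rightarrow> (complex \<Rightarrow> 'a \<Rightarrow> 'a) \<Rightarrow> ('a \<Rightarrow> 'a \<Rightarrow> complex) \<Rightarrow> complex \<Rightarrow>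
   'a operator \<Rightarrow> 'a operator \<Rightarrow> 'a operator \<Rightarrow>
   (real \<Rightarrow> complex) \<Rightarrow> (real \<Rightarrow> 'a operator) \<Rightarrow> (real \<Rightarrow> 'a operator) \<Rightarrow>
   (real \<Rightarrow> 'a::banach operator) \<Rightarrow> bool"
  where "solves_system K scl ip \<alpha> B C D s P Q R \<longleftrightarrow>
    s 0 = 1 \<and> P 0 = 0 \<and> Q 0 = 0 \<and> R 0 = id_blinfun \<and>
    (\<forall>t\<ge>0.
      linear_over K scl (P t) \<and> linear_over K scl (Q t) \<and> linear_over K scl (R t) \<and>
      nuclear_op scl ip (C o\<^sub>L Q t) \<and>
      (s has_vector_derivative - (1/2) * s t * trace_op ip (C o\<^sub>L Q t) + \<alpha> * s t)
        (at t within {0..}) \<and>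
      (P has_vector_derivative adjoint_op ip (R t) o\<^sub>L C o\<^sub>L R t) (at t within {0..}) \<and>
      (Q has_vector_derivative
          B - (Q t o\<^sub>L C o\<^sub>L Q t) + (adjoint_op ip D o\<^sub>L Q t) + (Q t o\<^sub>L D))
        (at t within {0..}) \<and>
      (R has_vector_derivative - (Q t o\<^sub>L C o\<^sub>L R t) + (adjoint_op ip D o\<^sub>L R t))
        (at t within {0..}))"

end

theory Submission
  imports Defs
begin

text \<open>
  For \<open>D = 0\<close> the system is a Riccati equation for \<open>Q\<close>, together with equations for \<open>R\<close>, \<open>P\<close>
  and \<open>s\<close> that become linear once \<open>Q\<close> is known. Write \<open>A = BC\<close> and
  \<open>f(t) = tanh(t \<surd>A)/\<surd>A\<close>. All functions of \<open>A\<close> commute, so that scalar calculus applies and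
  gives \<open>f' = 1 - f A f = cosh\<^sup>-\<^sup>2\<close>. Multiplying by \<open>B\<close> on the right yields the equation of
  \<open>Q = f B\<close>, multiplying by \<open>C\<close> on the left the one of \<open>P = C f\<close>, because
  \<open>C cosh\<^sup>-\<^sup>1(t \<surd>(BC)) = cosh\<^sup>-\<^sup>1(t \<surd>(CB)) C\<close> and \<open>cosh\<^sup>-\<^sup>1(t \<surd>(CB))\<close> is the adjoint of
  \<open>R = cosh\<^sup>-\<^sup>1(t \<surd>(BC))\<close>. Three points need an argument of their own.

  \<^emph>\<open>The hyperbolic cosine is invertible.\<close> By its Maclaurin series it equals \<open>I + B Y\<close>, where \<open>Y\<close> is a
  combination with nonnegative coefficients of the operators \<open>C (BC)\<^sup>n\<close>, which are symmetric
  and nonnegative. For symmetric nonnegative \<open>B\<close> and \<open>Y\<close> the inner product of \<open>x + BYx\<close> with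
  \<open>Yx\<close> controls \<open>\<parallel>Yx\<parallel>\<close> and hence \<open>\<parallel>x\<parallel>\<close> (\<open>bounded_below_id_plus_comp\<close>). The bound is uniform along
  the segment from \<open>I\<close> to \<open>I + B Y\<close>, so invertibility propagates along it
  (\<open>inverse_pair_id_plus_comp\<close>). This avoids operator square roots and spectral theory.

  \<^emph>\<open>The determinant.\<close> The claim about \<open>s\<close> amounts to
  \<open>(log det cosh(t \<surd>(CB)))' = tr (C Q(t))\<close>. For the compression of \<open>cosh(t \<surd>(CB))\<close> to the span of a
  finite part \<open>F\<close> of an orthonormal basis this is Jacobi's formula
  (\<open>leibniz_det_has_vector_derivative\<close>), with a logarithmic derivative \<open>g\<^sub>F\<close> in place of the trace.
  Since \<open>CB\<close> is nuclear, its compressions converge to it, and \<open>g\<^sub>F\<close> converges to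
  \<open>tr (C Q)\<close> uniformly on compact time intervals (\<open>compressed_det_has_vector_derivative\<close>).
  A scalar linear equation whose coefficient is
  uniformly small has almost constant solutions (\<open>linear_growth_near_constant\<close>), so the finite
  determinants converge to the exponential of the integral of \<open>tr (C Q)\<close>, whatever the basis is
  (\<open>det_op_hyp_0\<close>). The trace is real, hence the determinant is positive and its power
  \<open>-1/2\<close> is the exponential of half the negative integral.

  \<^emph>\<open>Uniqueness.\<close> The difference of two solutions for \<open>Q\<close>, then for \<open>R\<close>, \<open>P\<close> and \<open>s\<close>, vanishes at
  \<open>0\<close> and has a derivative bounded by a locally bounded multiple of its norm, so it is zero (\<open>ode_unique\<close>).
\<close>

section \<open>Linear differential inequalities\<close>

lemma has_vector_derivative_interior:
  fixes f :: "real \<Rightarrow> 'b::real_normed_vector"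
  assumes "(f has_vector_derivative d) (at v within {0..T})" "0 < v" "v < T"
  shows "(f has_vector_derivative d) (at v)"
proof -
  have "v \<in> {0<..<T}" using assms(2,3) by simp
  moreover have "(f has_vector_derivative d) (at v within {0<..<T})"
    using assms(1) by (rule has_vector_derivative_within_subset) auto
  ultimately show ?thesis
    by (rule has_vector_derivative_within_open[OF _ open_greaterThanLessThan, THEN iffD1])
qed

lemma continuous_on_interval_bounded:
  fixes f :: "real \<Rightarrow> 'b::real_normed_vector"
  assumes "continuous_on {0..T} f"
  obtains m where "m \<ge> 0" "\<And>t. t \<in> {0..T} \<Longrightarrow> norm (f t) \<le> m"
proof -
  have "bounded (f ` {0..T})"
    using assms by (intro compact_imp_bounded compact_continuous_image) auto
  then obtain m where "0 < m" "\<forall>y\<in>f ` {0..T}. norm y \<le> m"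
    unfolding bounded_pos by blast
  then show thesis using that[of m] by auto
qed

text \<open>
  Gronwall's lemma for values in a normed space, where the norm need not be differentiable: integrating
  the growth bound \<open>n\<close> times shows \<open>\<parallel>f(t)\<parallel> \<le> m (L t)\<^sup>n / n!\<close> for every \<open>n\<close>.
\<close>

lemma linear_growth_zero:
  fixes f :: "real \<Rightarrow> 'b::real_normed_vector"
  assumes f: "\<And>t. t \<in> {0..T} \<Longrightarrow> (f has_vector_derivative f' t) (at t within {0..T})"
    and f': "\<And>t. t \<in> {0..T} \<Longrightarrow> norm (f' t) \<le> L * norm (f t)"
    and f0: "f 0 = 0" and t: "t \<in> {0..T}"
  shows "f t = 0"
proof -
  have cont: "continuous_on {0..T} f"
    by (auto simp: continuous_on_eq_continuous_within intro: has_vector_derivative_continuous f)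
  then obtain m where m: "\<And>u. u \<in> {0..T} \<Longrightarrow> norm (f u) \<le> m"
    by (rule continuous_on_interval_bounded) blast
  \<comment> \<open>A negative \<open>L\<close> would spoil the monotonicity used in the induction.\<close>
  define l where "l = max L 0"
  have l: "l \<ge> 0" by (simp add: l_def)
  have f'l: "norm (f' t) \<le> l * norm (f t)" if "t \<in> {0..T}" for t
    using f'[OF that] by (rule order_trans) (simp add: l_def mult_right_mono)
  have bound: "norm (f u) \<le> m * (l * u) ^ n / fact n" if "u \<in> {0..T}" for u n
    using that
  proof (induction n arbitrary: u)
    case 0
    then show ?case using m by simp
  next
    case (Suc n)
    show ?case
    proof (cases "u = 0")
      case True
      then show ?thesis using f0 by simp
    next
      case False
      then have u: "0 < u" "u \<le> T" using Suc.prems by auto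
      let ?g = "\<lambda>v. m * (l * v) ^ Suc n / fact (Suc n)"
      have g': "(?g has_vector_derivative l * (m * (l * v) ^ n / fact n)) (at v)" for v
      proof -
        have "((\<lambda>v. l * v) has_real_derivative l) (at v)"
          by (auto intro!: derivative_eq_intros)
        from DERIV_power_Suc[OF this, of n]
        have "(?g has_real_derivative m * ((1 + of_nat n) * (l * (l * v) ^ n)) / fact (Suc n)) (at v)"
          by (intro DERIV_cdivide DERIV_cmult)
        also have "m * ((1 + of_nat n) * (l * (l * v) ^ n)) / fact (Suc n) = l * (m * (l * v) ^ n / fact n)"
          using of_nat_neq_0[of n, where 'a=real]
          by (simp add: divide_simps del: of_nat_neq_0)
        finally show ?thesis by (simp add: has_real_derivative_iff_has_vector_derivative)
      qed
      have "norm (f u - f 0) \<le> ?g u - ?g 0"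
      proof (rule differentiable_bound_general[OF u(1)])
        show "continuous_on {0..u} f" using cont u by (auto intro: continuous_on_subset)
        show "continuous_on {0..u} ?g" by (intro continuous_intros) auto
        fix v assume v: "0 < v" "v < u"
        show "(f has_vector_derivative f' v) (at v)"
          by (rule has_vector_derivative_interior[OF f]) (use v u in auto)
        show "(?g has_vector_derivative l * (m * (l * v) ^ n / fact n)) (at v)" by (rule g')
        have "v \<in> {0..T}" using v u by auto
        then show "norm (f' v) \<le> l * (m * (l * v) ^ n / fact n)"
          using f'l[of v] mult_left_mono[OF Suc.IH[of v] l] by linarith
      qed
      then show ?thesis by (simp add: f0)
    qed
  qed
  have "(\<lambda>n. m * ((l * t) ^ n / fact n)) \<longlonglongrightarrow> m * 0"
    using summable_LIMSEQ_zero[OF summable_exp[of "l * t"]]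
    by (intro tendsto_intros) (simp add: field_simps)
  then have "norm (f t) \<le> 0"
    using bound[OF t] by (intro LIMSEQ_le_const[of "\<lambda>n. m * ((l * t) ^ n / fact n)"]) auto
  then show ?thesis by simp
qed

text \<open>
  The maximum \<open>m\<close> of \<open>\<parallel>q\<parallel>\<close> on the interval satisfies \<open>m \<le> \<parallel>q(0)\<parallel> + \<epsilon> T m\<close>, and \<open>\<epsilon> T \<le> 1/2\<close> makes
  this \<open>m \<le> 2 \<parallel>q(0)\<parallel>\<close>; the derivative is then at most \<open>2 \<epsilon> \<parallel>q(0)\<parallel>\<close>.
\<close>

lemma linear_growth_near_constant:
  fixes q :: "real \<Rightarrow> 'b::real_normed_vector"
  assumes q: "\<And>t. t \<in> {0..T} \<Longrightarrow> (q has_vector_derivative q' t) (at t within {0..T})"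
    and q': "\<And>t. t \<in> {0..T} \<Longrightarrow> norm (q' t) \<le> \<epsilon> * norm (q t)"
    and \<epsilon>: "0 \<le> \<epsilon>" "\<epsilon> * T \<le> 1/2" and t: "t \<in> {0..T}"
  shows "norm (q t - q 0) \<le> 2 * \<epsilon> * T * norm (q 0)"
proof -
  have cont: "continuous_on {0..T} q"
    by (auto simp: continuous_on_eq_continuous_within intro: has_vector_derivative_continuous q)
  have "\<exists>u\<in>{0..T}. \<forall>v\<in>{0..T}. norm (q v) \<le> norm (q u)"
    by (intro continuous_attains_sup continuous_on_norm cont) (use t in auto)
  then obtain v where v: "v \<in> {0..T}" and max: "\<And>u. u \<in> {0..T} \<Longrightarrow> norm (q u) \<le> norm (q v)"
    by blast
  let ?m = "norm (q v)"
  have diff: "norm (q u - q 0) \<le> \<epsilon> * ?m * T" if u: "u \<in> {0..T}" for u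
  proof (cases "u = 0")
    case True
    then show ?thesis using \<epsilon> u by simp
  next
    case False
    then have u0: "0 < u" using u by simp
    have "norm (q u - q 0) \<le> \<epsilon> * ?m * u - \<epsilon> * ?m * 0"
    proof (rule differentiable_bound_general[OF u0])
      show "continuous_on {0..u} q" using cont u by (auto intro: continuous_on_subset)
      show "continuous_on {0..u} (\<lambda>x. \<epsilon> * ?m * x)" by (intro continuous_intros)
      fix x assume x: "0 < x" "x < u"
      have xT: "x \<in> {0..T}" using x u by auto
      show "(q has_vector_derivative q' x) (at x)"
        by (rule has_vector_derivative_interior[OF q]) (use x u in auto)
      have "((\<lambda>x. \<epsilon> * ?m * x) has_real_derivative \<epsilon> * ?m) (at x)"
        by (auto intro!: derivative_eq_intros)
      then show "((\<lambda>x. \<epsilon> * ?m * x) has_vector_derivative \<epsilon> * ?m) (at x)"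
        by (simp add: has_real_derivative_iff_has_vector_derivative)
      show "norm (q' x) \<le> \<epsilon> * ?m"
        using q'[OF xT] mult_left_mono[OF max[OF xT] \<epsilon>(1)] by linarith
    qed
    also have "\<dots> \<le> \<epsilon> * ?m * T"
      using u \<epsilon> by (simp add: mult_left_mono)
    finally show ?thesis .
  qed
  have "?m \<le> norm (q 0) + \<epsilon> * T * ?m"
    using diff[OF v] norm_triangle_sub[of "q v" "q 0"] by (simp add: mult_ac)
  also have "\<epsilon> * T * ?m \<le> 1/2 * ?m"
    using \<epsilon> by (intro mult_right_mono) auto
  finally have m: "?m \<le> 2 * norm (q 0)" by simp
  have "\<epsilon> * ?m * T \<le> \<epsilon> * (2 * norm (q 0)) * T"
    using m \<epsilon> t by (intro mult_right_mono mult_left_mono) auto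
  with diff[OF t] show ?thesis by (simp add: mult_ac)
qed

lemma ode_unique:
  fixes x y :: "real \<Rightarrow> 'b::real_normed_vector"
  assumes x: "\<And>t. t \<ge> 0 \<Longrightarrow> (x has_vector_derivative x' t) (at t within {0..})"
    and y: "\<And>t. t \<ge> 0 \<Longrightarrow> (y has_vector_derivative y' t) (at t within {0..})"
    and L: "continuous_on {0..} L" "\<And>t. t \<ge> 0 \<Longrightarrow> norm (x' t - y' t) \<le> L t * norm (x t - y t)"
    and init: "x 0 = y 0" and t: "t \<ge> 0"
  shows "x t = y t"
proof -
  have "continuous_on {0..t} L" using L(1) by (rule continuous_on_subset) auto
  then obtain m where m: "\<And>u. u \<in> {0..t} \<Longrightarrow> norm (L u) \<le> m"
    by (rule continuous_on_interval_bounded) blast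
  have "x t - y t = 0"
  proof (rule linear_growth_zero[where f="\<lambda>u. x u - y u" and f'="\<lambda>u. x' u - y' u" and L=m])
    fix u assume u: "u \<in> {0..t}"
    then have u0: "u \<ge> 0" by simp
    show "((\<lambda>u. x u - y u) has_vector_derivative x' u - y' u) (at u within {0..t})"
      by (rule has_vector_derivative_within_subset[OF has_vector_derivative_diff[OF x[OF u0] y[OF u0]]]) auto
    have "L u \<le> m" using m[OF u] by simp
    from mult_right_mono[OF this norm_ge_zero[of "x u - y u"]]
    show "norm (x' u - y' u) \<le> m * norm (x u - y u)" using L(2)[OF u0] by linarith
  qed (use init t in auto)
  then show ?thesis by simp
qed

lemma has_vector_derivative_within_ray:
  assumes "(f has_vector_derivative D) (at t within {0..t + 1})" "t \<ge> 0"
  shows "(f has_vector_derivative D) (at t within {0..})"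
proof -
  have "at t within {0..t + 1} = at t within {0..}"
    by (rule at_within_nhd[of t "{..<t + 1}"]) (use assms(2) in auto)
  with assms(1) show ?thesis by simp
qed

lemma has_vector_derivative_ray_cong:
  assumes "\<And>u. u \<ge> 0 \<Longrightarrow> g u = f u" "t \<ge> 0"
  shows "(g has_vector_derivative d) (at t within {0..}) \<longleftrightarrow> (f has_vector_derivative d) (at t within {0..})"
  using assms by (intro iffI) (auto elim!: has_vector_derivative_transform[rotated 2])

section \<open>Power series of a bounded operator\<close>

interpretation op_comp: bounded_bilinear "(o\<^sub>L)"
  by (rule bounded_bilinear_blinfun_compose)

lemma op_comp_assoc: "(a o\<^sub>L b) o\<^sub>L c = a o\<^sub>L (b o\<^sub>L c)"
  by (rule blinfun_eqI) simp

lemma id_op_comp [simp]: "id_blinfun o\<^sub>L a = a" "a o\<^sub>L id_blinfun = a"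
  by (rule blinfun_eqI, simp)+

lemma power_op_0 [simp]: "power_op A 0 = id_blinfun"
  by (simp add: power_op_def)

lemma power_op_Suc [simp]: "power_op A (Suc n) = A o\<^sub>L power_op A n"
  by (simp add: power_op_def)

lemma norm_power_op_le: "norm (power_op A n) \<le> norm A ^ n"
proof (induction n)
  case 0
  then show ?case by (simp add: norm_blinfun_id_le)
next
  case (Suc n)
  have "norm (power_op A (Suc n)) \<le> norm A * norm (power_op A n)"
    by (simp add: norm_blinfun_compose)
  also have "\<dots> \<le> norm A * norm A ^ n"
    using Suc by (intro mult_left_mono) auto
  finally show ?case by simp
qed

text \<open>
  Intertwining rather than commutation is the useful notion here: with \<open>X = C\<close>, \<open>A = BC\<close> and \<open>A' = CB\<close>
  it carries functions of \<open>BC\<close> to functions of \<open>CB\<close>.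
\<close>

lemma power_op_intertwine:
  assumes "X o\<^sub>L A = A' o\<^sub>L X"
  shows "X o\<^sub>L power_op A n = power_op A' n o\<^sub>L X"
proof (induction n)
  case (Suc n)
  have "X o\<^sub>L power_op A (Suc n) = (A' o\<^sub>L X) o\<^sub>L power_op A n"
    by (simp add: assms flip: op_comp_assoc)
  also have "\<dots> = power_op A' (Suc n) o\<^sub>L X"
    using Suc by (simp add: op_comp_assoc)
  finally show ?case .
qed simp

definition op_series :: "(nat \<Rightarrow> real) \<Rightarrow> 'a::banach operator \<Rightarrow> 'a operator"
  where "op_series c A = (\<Sum>n. c n *\<^sub>R power_op A n)"

lemma norm_op_series_term_le: "norm (c n *\<^sub>R power_op A n) \<le> \<bar>c n\<bar> * norm A ^ n"
  by (auto intro: mult_left_mono norm_power_op_le)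

context
  fixes c :: "nat \<Rightarrow> real" and k :: real
  assumes c: "summable (\<lambda>n. \<bar>c n\<bar> * k ^ n)"
begin

lemma op_series_sums:
  assumes "norm A \<le> k"
  shows "(\<lambda>n. c n *\<^sub>R power_op A n) sums op_series c A"
proof -
  have "norm (c n *\<^sub>R power_op A n) \<le> \<bar>c n\<bar> * k ^ n" for n
    by (rule order_trans[OF norm_op_series_term_le])
      (auto intro!: mult_left_mono power_mono assms)
  then show ?thesis
    unfolding op_series_def by (intro summable_sums summable_comparison_test'[OF c])
qed

lemma op_series_intertwine:
  assumes "norm A \<le> k" "norm A' \<le> k" "X o\<^sub>L A = A' o\<^sub>L X"
  shows "X o\<^sub>L op_series c A = op_series c A' o\<^sub>L X"
proof (rule sums_unique2)
  show "(\<lambda>n. X o\<^sub>L (c n *\<^sub>R power_op A n)) sums (X o\<^sub>L op_series c A)"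
    by (rule bounded_linear.sums[OF op_comp.bounded_linear_right op_series_sums]) fact
  have "(\<lambda>n. (c n *\<^sub>R power_op A' n) o\<^sub>L X) sums (op_series c A' o\<^sub>L X)"
    by (rule bounded_linear.sums[OF op_comp.bounded_linear_left op_series_sums]) fact
  then show "(\<lambda>n. X o\<^sub>L (c n *\<^sub>R power_op A n)) sums (op_series c A' o\<^sub>L X)"
    by (simp add: op_comp.scaleR_left op_comp.scaleR_right power_op_intertwine[OF assms(3)])
qed

lemma op_series_Suc:
  assumes A: "norm A \<le> k" and c': "summable (\<lambda>n. \<bar>c (Suc n)\<bar> * k ^ n)"
  shows "op_series c A = c 0 *\<^sub>R id_blinfun + (A o\<^sub>L op_series (\<lambda>n. c (Suc n)) A)"
proof -
  have "(\<lambda>n. c (Suc n) *\<^sub>R power_op A n) sums op_series (\<lambda>n. c (Suc n)) A"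
  proof -
    have "norm (c (Suc n) *\<^sub>R power_op A n) \<le> \<bar>c (Suc n)\<bar> * k ^ n" for n
      by (rule order_trans[OF norm_op_series_term_le])
        (auto intro!: mult_left_mono power_mono A)
    then show ?thesis
      unfolding op_series_def by (intro summable_sums summable_comparison_test'[OF c'])
  qed
  then have "(\<lambda>n. A o\<^sub>L (c (Suc n) *\<^sub>R power_op A n)) sums (A o\<^sub>L op_series (\<lambda>n. c (Suc n)) A)"
    by (rule bounded_linear.sums[OF op_comp.bounded_linear_right])
  then have "(\<lambda>n. c (Suc n) *\<^sub>R power_op A (Suc n)) sums (A o\<^sub>L op_series (\<lambda>n. c (Suc n)) A)"
    by (simp add: op_comp.scaleR_right)
  from sums_Suc[OF this] op_series_sums[OF A] show ?thesis
    by (auto dest: sums_unique2 simp: add.commute)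
qed

end

text \<open>Termwise differentiation; the majorant \<open>d\<close> makes the differentiated series converge uniformly.\<close>

lemma op_series_has_vector_derivative:
  fixes A :: "'a::banach operator"
  assumes c': "\<And>n u. \<bar>u\<bar> < T \<Longrightarrow> ((\<lambda>u. c u n) has_real_derivative c' u n) (at u)"
    and d: "\<And>n u. \<bar>u\<bar> < T \<Longrightarrow> \<bar>c' u n\<bar> \<le> d n" "summable (\<lambda>n. d n * norm A ^ n)"
    and c: "\<And>u. \<bar>u\<bar> < T \<Longrightarrow> summable (\<lambda>n. \<bar>c u n\<bar> * norm A ^ n)"
    and t: "\<bar>t\<bar> < T"
  shows "((\<lambda>u. op_series (c u) A) has_vector_derivative op_series (c' t) A) (at t)"
proof -
  let ?S = "{- T<..<T}"
  let ?f' = "\<lambda>n u h. (h * c' u n) *\<^sub>R power_op A n"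
  have tS: "t \<in> ?S" using t by auto
  have "uniform_limit ?S (\<lambda>n u. \<Sum>i<n. c' u i *\<^sub>R power_op A i) (\<lambda>u. op_series (c' u) A) sequentially"
    unfolding op_series_def
  proof (rule Weierstrass_m_test[OF _ d(2)])
    fix n u assume "u \<in> ?S"
    then have "\<bar>u\<bar> < T" by auto
    from mult_right_mono[OF d(1)[OF this, of n], of "norm A ^ n"]
    show "norm (c' u n *\<^sub>R power_op A n) \<le> d n * norm A ^ n"
      using norm_op_series_term_le[of "c' u" n A] by simp
  qed
  then have unif: "\<forall>\<^sub>F n in sequentially. \<forall>u\<in>?S.
      dist (\<Sum>i<n. c' u i *\<^sub>R power_op A i) (op_series (c' u) A) < e" if "e > 0" for e
    using that by (rule uniform_limitD)
  have "\<exists>g. \<forall>u\<in>?S. (\<lambda>n. c u n *\<^sub>R power_op A n) sums g u \<and>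
      (g has_derivative (\<lambda>h. h *\<^sub>R op_series (c' u) A)) (at u within ?S)"
  proof (rule has_derivative_series)
    show "((\<lambda>u. c u n *\<^sub>R power_op A n) has_derivative ?f' n u) (at u within ?S)"
      if "u \<in> ?S" for n u
    proof -
      have "((\<lambda>u. c u n) has_vector_derivative c' u n) (at u)"
        using c'[of u n] that by (auto simp: has_real_derivative_iff_has_vector_derivative)
      from bounded_linear.has_vector_derivative[OF bounded_linear_scaleR_left this, of "power_op A n"]
      show ?thesis
        by (auto simp: has_vector_derivative_def intro: has_derivative_at_withinI)
    qed
    show "\<forall>\<^sub>F n in sequentially. \<forall>u\<in>?S. \<forall>h.
        norm ((\<Sum>i<n. ?f' i u h) - h *\<^sub>R op_series (c' u) A) \<le> e * norm h" if "e > 0" for e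
      using unif[OF that]
    proof eventually_elim
      case (elim n)
      show ?case
      proof (intro ballI allI)
        fix u h :: real assume "u \<in> ?S"
        have "(\<Sum>i<n. ?f' i u h) - h *\<^sub>R op_series (c' u) A
            = h *\<^sub>R ((\<Sum>i<n. c' u i *\<^sub>R power_op A i) - op_series (c' u) A)"
          by (simp add: scaleR_diff_right scaleR_sum_right)
        also have "norm \<dots> \<le> \<bar>h\<bar> * e"
        proof -
          have "norm ((\<Sum>i<n. c' u i *\<^sub>R power_op A i) - op_series (c' u) A) \<le> e"
            using elim \<open>u \<in> ?S\<close> unfolding dist_norm by (blast intro: less_imp_le)
          from mult_left_mono[OF this abs_ge_zero[of h]] show ?thesis by simp
        qed
        finally show "norm ((\<Sum>i<n. ?f' i u h) - h *\<^sub>R op_series (c' u) A) \<le> e * norm h"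
          by (simp add: mult.commute)
      qed
    qed
    show "(\<lambda>n. c t n *\<^sub>R power_op A n) sums op_series (c t) A"
      by (rule op_series_sums[OF c[OF t] order_refl])
  qed (use tS in auto)
  then obtain g where "\<forall>u\<in>?S. (\<lambda>n. c u n *\<^sub>R power_op A n) sums g u \<and>
      (g has_derivative (\<lambda>h. h *\<^sub>R op_series (c' u) A)) (at u within ?S)" ..
  then have g: "\<And>u. u \<in> ?S \<Longrightarrow> (\<lambda>n. c u n *\<^sub>R power_op A n) sums g u"
      "\<And>u. u \<in> ?S \<Longrightarrow> (g has_derivative (\<lambda>h. h *\<^sub>R op_series (c' u) A)) (at u within ?S)"
    by simp_all
  have "(g has_vector_derivative op_series (c' t) A) (at t)"
    using g(2)[OF tS]
    by (simp add: has_vector_derivative_def at_within_open[OF tS open_greaterThanLessThan])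
  then show ?thesis
  proof (rule has_vector_derivative_transform_within_open[OF _ open_greaterThanLessThan tS])
    show "g u = op_series (c u) A" if "u \<in> ?S" for u
      using g(1)[OF that] by (simp add: op_series_def sums_iff)
  qed
qed

section \<open>Inverse operators\<close>

definition inverse_pair :: "'a::real_normed_vector operator \<Rightarrow> 'a operator \<Rightarrow> bool"
  where "inverse_pair T S \<longleftrightarrow> T o\<^sub>L S = id_blinfun \<and> S o\<^sub>L T = id_blinfun"

lemma inverse_pair_unique:
  assumes "inverse_pair T S" "inverse_pair T S'"
  shows "S = S'"
proof -
  have "S = S o\<^sub>L (T o\<^sub>L S')" using assms by (simp add: inverse_pair_def)
  also have "\<dots> = S o\<^sub>L T o\<^sub>L S'" by (simp add: op_comp_assoc)
  also have "\<dots> = S'" using assms by (simp add: inverse_pair_def)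
  finally show ?thesis .
qed

lemma inverse_op_eq:
  assumes "inverse_pair T S"
  shows "inverse_op T = S"
  unfolding inverse_op_def inverse_pair_def[symmetric]
  by (rule the_equality[of "inverse_pair T", OF assms]) (rule inverse_pair_unique[OF _ assms])

lemma inverse_pair_apply:
  assumes "inverse_pair T S"
  shows "T (S x) = x" "S (T x) = x"
  using assms unfolding inverse_pair_def by (simp_all flip: blinfun_apply_blinfun_compose)

lemma inverse_op_id: "inverse_op id_blinfun = id_blinfun"
  by (rule inverse_op_eq) (simp add: inverse_pair_def)

text \<open>Multiply \<open>X T = T' X\<close> by \<open>S'\<close> on the left and by \<open>S\<close> on the right.\<close>

lemma inverse_pair_intertwine:
  assumes "inverse_pair T S" "inverse_pair T' S'" "X o\<^sub>L T = T' o\<^sub>L X"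
  shows "X o\<^sub>L S = S' o\<^sub>L X"
proof -
  have "X o\<^sub>L S = S' o\<^sub>L (T' o\<^sub>L X) o\<^sub>L S"
    using assms(2) by (simp add: inverse_pair_def flip: op_comp_assoc)
  also have "\<dots> = S' o\<^sub>L X o\<^sub>L (T o\<^sub>L S)"
    by (simp add: assms(3)[symmetric] op_comp_assoc)
  finally show ?thesis using assms(1) by (simp add: inverse_pair_def)
qed

lemma inverse_pair_neumann:
  fixes X :: "'a::banach operator"
  assumes X: "norm X < 1"
  obtains S where "inverse_pair (id_blinfun + X) S"
proof -
  let ?S = "op_series (\<lambda>_. 1) (- X)"
  have *: "summable (\<lambda>n. \<bar>1::real\<bar> * norm X ^ n)"
    using X by (simp add: summable_geometric)
  have "?S = id_blinfun - (X o\<^sub>L ?S)"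
    using op_series_Suc[OF *, of "- X"] * by (simp add: op_comp.minus_left)
  moreover have "X o\<^sub>L ?S = ?S o\<^sub>L X"
    by (rule op_series_intertwine[OF *]) (auto simp: op_comp.minus_left op_comp.minus_right)
  ultimately have "?S + (X o\<^sub>L ?S) = id_blinfun" "?S + (?S o\<^sub>L X) = id_blinfun"
    by (simp_all add: eq_diff_eq)
  then have "inverse_pair (id_blinfun + X) ?S"
    by (simp add: inverse_pair_def op_comp.add_left op_comp.add_right)
  with that show thesis .
qed

text \<open>The quantitative form of the openness of the invertible operators.\<close>

text \<open>
  The quantitative form of the openness of the set of invertible operators. The factorisation
  \<open>U = V (I + W (U - V))\<close> reduces it to a Neumann series, and \<open>Z - W = - W (U - V) Z\<close> gives both norm
  bounds. They depend on \<open>W\<close> only through \<open>\<kappa>\<close>, which makes them uniform over compact time intervals.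
\<close>

lemma inverse_pair_perturb:
  fixes U V W :: "'a::banach operator"
  assumes VW: "inverse_pair V W" and W: "norm W \<le> \<kappa>" and small: "norm (U - V) * \<kappa> \<le> 1/2"
  obtains Z where "inverse_pair U Z" "norm Z \<le> 2 * \<kappa>" "norm (Z - W) \<le> 2 * \<kappa>\<^sup>2 * norm (U - V)"
proof -
  have k0: "\<kappa> \<ge> 0" using W norm_ge_zero order_trans by blast
  let ?X = "W o\<^sub>L (U - V)"
  have "norm ?X \<le> norm W * norm (U - V)" by (rule norm_blinfun_compose)
  also have "\<dots> \<le> norm (U - V) * \<kappa>"
    using mult_right_mono[OF W norm_ge_zero[of "U - V"]] by (simp add: mult.commute)
  finally have "norm ?X < 1" using small by linarith
  then obtain S where S: "inverse_pair (id_blinfun + ?X) S"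
    by (rule inverse_pair_neumann)
  have U: "U = V o\<^sub>L (id_blinfun + ?X)"
    using VW by (simp add: inverse_pair_def op_comp.add_right flip: op_comp_assoc)
  define Z where "Z = S o\<^sub>L W"
  have "U o\<^sub>L Z = V o\<^sub>L ((id_blinfun + ?X) o\<^sub>L S) o\<^sub>L W"
    by (subst U) (simp add: Z_def op_comp_assoc)
  moreover have "Z o\<^sub>L U = S o\<^sub>L ((W o\<^sub>L V) o\<^sub>L (id_blinfun + ?X))"
    by (subst U) (simp add: Z_def op_comp_assoc)
  ultimately have Z: "inverse_pair U Z"
    using S VW by (simp add: inverse_pair_def)
  have diff: "Z - W = - (W o\<^sub>L (U - V) o\<^sub>L Z)"
  proof -
    have "W o\<^sub>L (U - V) o\<^sub>L Z = (W o\<^sub>L (U o\<^sub>L Z)) - ((W o\<^sub>L V) o\<^sub>L Z)"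
      by (simp only: op_comp.diff_left op_comp.diff_right op_comp_assoc)
    also have "\<dots> = W - Z"
      using Z VW by (simp only: inverse_pair_def id_op_comp)
    finally show ?thesis by simp
  qed
  have le: "norm (Z - W) \<le> \<kappa> * norm (U - V) * norm Z"
  proof -
    have "norm (Z - W) \<le> norm (W o\<^sub>L (U - V)) * norm Z"
      unfolding diff by (simp add: norm_blinfun_compose)
    also have "\<dots> \<le> (norm W * norm (U - V)) * norm Z"
      by (intro mult_right_mono norm_blinfun_compose) auto
    also have "\<dots> \<le> \<kappa> * norm (U - V) * norm Z"
      using W by (intro mult_right_mono) auto
    finally show ?thesis .
  qed
  also have "\<dots> \<le> 1/2 * norm Z"
    using small by (intro mult_right_mono) (auto simp: mult.commute)
  finally have "norm Z \<le> 2 * \<kappa>"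
    using W norm_triangle_sub[of Z W] by linarith
  moreover have "norm (Z - W) \<le> 2 * \<kappa>\<^sup>2 * norm (U - V)"
  proof -
    have "\<kappa> * norm (U - V) * norm Z \<le> \<kappa> * norm (U - V) * (2 * \<kappa>)"
      using calculation k0 by (intro mult_left_mono) auto
    with le show ?thesis by (simp add: power2_eq_square algebra_simps)
  qed
  ultimately show thesis using Z that by blast
qed

lemma inverse_pair_continuous:
  fixes U W :: "real \<Rightarrow> 'a::banach operator"
  assumes inv: "\<And>u. u \<in> S \<Longrightarrow> inverse_pair (U u) (W u)" and t: "t \<in> S"
    and U: "(U \<longlongrightarrow> U t) (at t within S)"
  shows "(W \<longlongrightarrow> W t) (at t within S)"
proof -
  let ?k = "norm (W t)"
  have lim: "((\<lambda>u. norm (U u - U t)) \<longlongrightarrow> 0) (at t within S)"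
    using U by (simp add: LIM_zero tendsto_norm_zero)
  have "((\<lambda>u. norm (U u - U t) * ?k) \<longlongrightarrow> 0 * ?k) (at t within S)"
    by (intro tendsto_intros lim)
  then have "\<forall>\<^sub>F u in at t within S. norm (U u - U t) * ?k < 1/2"
    by (intro order_tendstoD) auto
  moreover have "\<forall>\<^sub>F u in at t within S. u \<in> S"
    by (simp add: eventually_at_filter)
  ultimately have "\<forall>\<^sub>F u in at t within S. norm (W u - W t) \<le> 2 * ?k\<^sup>2 * norm (U u - U t)"
  proof eventually_elim
    case (elim u)
    then have small: "norm (U u - U t) * ?k \<le> 1/2" by simp
    obtain Z where Z: "inverse_pair (U u) Z" "norm (Z - W t) \<le> 2 * ?k\<^sup>2 * norm (U u - U t)"
      by (rule inverse_pair_perturb[OF inv[OF t] order_refl small])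
    have "Z = W u" using Z(1) inv elim by (blast intro: inverse_pair_unique)
    with Z(2) show ?case by simp
  qed
  moreover have "((\<lambda>u. 2 * ?k\<^sup>2 * norm (U u - U t)) \<longlongrightarrow> 0) (at t within S)"
    using tendsto_mult_left[OF lim, of "2 * ?k\<^sup>2"] by (simp only: mult_zero_right)
  ultimately have "((\<lambda>u. W u - W t) \<longlongrightarrow> 0) (at t within S)"
    by (rule Lim_null_comparison)
  then show ?thesis by (rule LIM_zero_cancel)
qed

lemma has_vector_derivative_iff_quotient:
  fixes f :: "real \<Rightarrow> 'b::real_normed_vector"
  shows "(f has_vector_derivative D) (at t within S) \<longleftrightarrow>
    ((\<lambda>u. (f u - f t) /\<^sub>R (u - t)) \<longlongrightarrow> D) (at t within S)"
proof -
  have *: "norm (f u - f t - (u - t) *\<^sub>R D) / norm (u - t) = norm ((f u - f t) /\<^sub>R (u - t) - D)"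
    if "u \<noteq> t" for u
  proof -
    have "f u - f t - (u - t) *\<^sub>R D = (u - t) *\<^sub>R ((f u - f t) /\<^sub>R (u - t) - D)"
      using that by (simp add: scaleR_diff_right)
    then show ?thesis using that by (simp only: norm_scaleR) simp
  qed
  have "(f has_vector_derivative D) (at t within S) \<longleftrightarrow>
      ((\<lambda>u. norm (f u - f t - (u - t) *\<^sub>R D) / norm (u - t)) \<longlongrightarrow> 0) (at t within S)"
    by (simp add: has_vector_derivative_def has_derivative_iff_norm bounded_linear_scaleR_left)
  also have "\<dots> \<longleftrightarrow> ((\<lambda>u. norm ((f u - f t) /\<^sub>R (u - t) - D)) \<longlongrightarrow> 0) (at t within S)"
    by (intro filterlim_cong refl)
      (simp add: eventually_at_filter always_eventually * del: real_norm_def)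
  finally show ?thesis by (simp add: tendsto_norm_zero_iff LIM_zero_iff)
qed

text \<open>
  Continuity of the inverse turns \<open>W(u) - W(t) = - W(u) (U(u) - U(t)) W(t)\<close> into the derivative.
\<close>

lemma inverse_pair_has_vector_derivative:
  fixes U W :: "real \<Rightarrow> 'a::banach operator"
  assumes inv: "\<And>u. u \<in> S \<Longrightarrow> inverse_pair (U u) (W u)" and t: "t \<in> S"
    and U: "(U has_vector_derivative D) (at t within S)"
  shows "(W has_vector_derivative - (W t o\<^sub>L D o\<^sub>L W t)) (at t within S)"
proof -
  have contW: "(W \<longlongrightarrow> W t) (at t within S)"
    using inverse_pair_continuous[of S U W, OF inv t] has_vector_derivative_continuous[OF U]
    by (auto simp: continuous_within)
  have "((\<lambda>u. (U u - U t) /\<^sub>R (u - t)) \<longlongrightarrow> D) (at t within S)"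
    using U by (simp add: has_vector_derivative_iff_quotient)
  then have "((\<lambda>u. - (W u o\<^sub>L ((U u - U t) /\<^sub>R (u - t)) o\<^sub>L W t)) \<longlongrightarrow> - (W t o\<^sub>L D o\<^sub>L W t)) (at t within S)"
    by (intro tendsto_intros op_comp.tendsto contW)
  moreover have "\<forall>\<^sub>F u in at t within S. - (W u o\<^sub>L ((U u - U t) /\<^sub>R (u - t)) o\<^sub>L W t) = (W u - W t) /\<^sub>R (u - t)"
    unfolding eventually_at_filter
  proof (intro always_eventually allI impI)
    fix u assume "u \<in> S"
    have "W u o\<^sub>L (U u - U t) o\<^sub>L W t = ((W u o\<^sub>L U u) o\<^sub>L W t) - (W u o\<^sub>L (U t o\<^sub>L W t))"
      by (simp only: op_comp.diff_left op_comp.diff_right op_comp_assoc)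
    also have "\<dots> = W t - W u"
      using inv[OF \<open>u \<in> S\<close>] inv[OF t] by (simp only: inverse_pair_def id_op_comp)
    finally show "- (W u o\<^sub>L ((U u - U t) /\<^sub>R (u - t)) o\<^sub>L W t) = (W u - W t) /\<^sub>R (u - t)"
      by (simp add: op_comp.scaleR_left op_comp.scaleR_right flip: scaleR_minus_right)
  qed
  ultimately have "((\<lambda>u. (W u - W t) /\<^sub>R (u - t)) \<longlongrightarrow> - (W t o\<^sub>L D o\<^sub>L W t)) (at t within S)"
    by (rule Lim_transform_eventually)
  then show ?thesis by (simp add: has_vector_derivative_iff_quotient)
qed

section \<open>Hyperbolic functions of the square root of an operator\<close>

text \<open>
  The family \<open>hyp j t A\<close> is \<open>\<Sum> t\<^sup>2\<^sup>n\<^sup>+\<^sup>j / (2n+j)! A\<^sup>n\<close>, the \<open>j\<close>-fold iterated integral of \<open>cosh(t \<surd>A)\<close>: it is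
  \<open>cosh(t \<surd>A)\<close> for \<open>j = 0\<close>, \<open>sinh(t \<surd>A)/\<surd>A\<close> for \<open>j = 1\<close> and \<open>(cosh(t \<surd>A) - 1)/A\<close> for \<open>j = 2\<close>. Treating
  all \<open>j\<close> at once leaves a single series to differentiate.
\<close>

definition hyp_coeff :: "nat \<Rightarrow> real \<Rightarrow> nat \<Rightarrow> real"
  where "hyp_coeff j t n = t ^ (2 * n + j) / fact (2 * n + j)"

definition hyp :: "nat \<Rightarrow> real \<Rightarrow> 'a::banach operator \<Rightarrow> 'a operator"
  where "hyp j t A = op_series (hyp_coeff j t) A"

lemma cosh_sqrt_eq_hyp: "cosh_sqrt t A = hyp 0 t A"
  by (simp add: cosh_sqrt_def hyp_def op_series_def hyp_coeff_def)

lemma sinh_sqrt_div_sqrt_eq_hyp: "sinh_sqrt_div_sqrt t A = hyp 1 t A"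
  by (simp add: sinh_sqrt_div_sqrt_def hyp_def op_series_def hyp_coeff_def)

lemma summable_hyp_coeff:
  fixes k :: real
  assumes "k \<ge> 0"
  shows "summable (\<lambda>n. \<bar>hyp_coeff j t n\<bar> * k ^ n)"
proof (rule summable_comparison_test')
  show "summable (\<lambda>n. \<bar>t\<bar> ^ j * (inverse (fact n) * (t\<^sup>2 * k) ^ n))"
    by (intro summable_mult summable_exp)
  fix n
  have "(fact n :: real) \<le> fact (2 * n + j)" by (rule fact_mono) simp
  then have "\<bar>t\<bar> ^ (2 * n + j) / fact (2 * n + j) * k ^ n \<le> \<bar>t\<bar> ^ (2 * n + j) / fact n * k ^ n"
    using assms by (intro mult_right_mono divide_left_mono) auto
  also have "\<dots> = \<bar>t\<bar> ^ j * (inverse (fact n) * (t\<^sup>2 * k) ^ n)"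
  proof -
    have "\<bar>t\<bar> ^ (2 * n) = (t\<^sup>2) ^ n" by (simp add: power_mult)
    then show ?thesis by (simp add: power_add power_mult_distrib field_simps)
  qed
  finally show "norm (\<bar>hyp_coeff j t n\<bar> * k ^ n) \<le> \<bar>t\<bar> ^ j * (inverse (fact n) * (t\<^sup>2 * k) ^ n)"
    using assms by (simp add: hyp_coeff_def power_abs)
qed

lemma hyp_sums: "(\<lambda>n. hyp_coeff j t n *\<^sub>R power_op A n) sums hyp j t A"
  unfolding hyp_def by (rule op_series_sums[OF summable_hyp_coeff order_refl]) simp

lemma hyp_apply_sums: "(\<lambda>n. hyp_coeff j t n *\<^sub>R power_op A n x) sums hyp j t A x"
  using bounded_linear.sums[OF blinfun.bounded_linear_left hyp_sums]
  by (simp add: blinfun.scaleR_left)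

lemma hyp_intertwine:
  assumes "X o\<^sub>L A = A' o\<^sub>L X"
  shows "X o\<^sub>L hyp j t A = hyp j t A' o\<^sub>L X"
  unfolding hyp_def
  by (rule op_series_intertwine[OF summable_hyp_coeff[of "max (norm A) (norm A')"]])
    (auto simp: assms le_max_iff_disj)

lemma hyp_commute: "A o\<^sub>L hyp j t A = hyp j t A o\<^sub>L A"
  by (rule hyp_intertwine) simp

lemma hyp_commute_hyp: "hyp i t A o\<^sub>L hyp j u A = hyp j u A o\<^sub>L hyp i t A"
  by (rule hyp_intertwine) (simp add: hyp_commute)

lemma hyp_recursion: "hyp j t A = (t ^ j / fact j) *\<^sub>R id_blinfun + (A o\<^sub>L hyp (j + 2) t A)"
proof -
  have "(\<lambda>n. hyp_coeff j t (Suc n)) = hyp_coeff (j + 2) t"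
    by (rule ext) (simp add: hyp_coeff_def)
  then show ?thesis
    using op_series_Suc[OF summable_hyp_coeff[of "norm A" j t] order_refl]
      summable_hyp_coeff[of "norm A" "j + 2" t]
    by (simp add: hyp_def) (simp add: hyp_coeff_def)
qed

lemma hyp_0_eq: "hyp 0 t A = id_blinfun + (A o\<^sub>L hyp 2 t A)"
  using hyp_recursion[of 0 t A] by (simp only: add_0 power_0 fact_0 div_by_1 scaleR_one)

lemma hyp_Suc_has_vector_derivative:
  "((\<lambda>t. hyp (Suc j) t A) has_vector_derivative hyp j t A) (at t)"
  unfolding hyp_def
proof (rule op_series_has_vector_derivative)
  show "((\<lambda>u. hyp_coeff (Suc j) u n) has_real_derivative hyp_coeff j u n) (at u)" for n u
  proof -
    have "((\<lambda>u. u ^ Suc (2 * n + j) / fact (Suc (2 * n + j))) has_real_derivative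
        (1 + of_nat (2 * n + j)) * (1 * u ^ (2 * n + j)) / fact (Suc (2 * n + j))) (at u)"
      by (intro DERIV_cdivide DERIV_power_Suc DERIV_ident)
    also have "(1 + of_nat (2 * n + j)) * (1 * u ^ (2 * n + j)) / fact (Suc (2 * n + j))
        = u ^ (2 * n + j) / (fact (2 * n + j) :: real)"
      unfolding fact_Suc of_nat_Suc by (simp add: of_nat_add)
    finally show ?thesis by (simp add: hyp_coeff_def)
  qed
  show "\<bar>hyp_coeff j u n\<bar> \<le> \<bar>hyp_coeff j (\<bar>t\<bar> + 1) n\<bar>" if "\<bar>u\<bar> < \<bar>t\<bar> + 1" for n u
    using that by (auto simp: hyp_coeff_def power_abs intro!: divide_right_mono power_mono)
qed (auto intro!: summable_hyp_coeff)

text \<open>Differentiating \<open>cosh(t \<surd>A)\<close> as \<open>1 + A \<integral>\<integral> cosh\<close> avoids a separate treatment of its constant term.\<close>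

lemma hyp_0_has_vector_derivative:
  "((\<lambda>t. hyp 0 t A) has_vector_derivative (A o\<^sub>L hyp 1 t A)) (at t)"
proof -
  have "((\<lambda>t. id_blinfun + (A o\<^sub>L hyp 2 t A)) has_vector_derivative 0 + (A o\<^sub>L hyp 1 t A)) (at t)"
    using hyp_Suc_has_vector_derivative[of 1 A t]
    by (intro has_vector_derivative_add has_vector_derivative_const
        bounded_linear.has_vector_derivative[OF op_comp.bounded_linear_right])
      (simp add: numeral_2_eq_2)
  then show ?thesis by (simp add: hyp_0_eq[abs_def])
qed

lemma continuous_on_hyp: "continuous_on S (\<lambda>t. hyp j t A)"
proof -
  have "\<exists>D. ((\<lambda>t. hyp j t A) has_vector_derivative D) (at t)" for t
    using hyp_0_has_vector_derivative hyp_Suc_has_vector_derivative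
    by (cases j) blast+
  then show ?thesis
    by (meson continuous_at_imp_continuous_on has_vector_derivative_continuous)
qed

lemma hyp_at_0: "hyp j 0 A = (if j = 0 then id_blinfun else 0)"
proof -
  have "hyp (Suc i) 0 A = 0" for i
    by (simp add: hyp_def op_series_def hyp_coeff_def)
  then show ?thesis using hyp_0_eq[of 0 A] by (cases j) (auto simp: numeral_2_eq_2)
qed

text \<open>\<open>cosh\<^sup>2 - sinh\<^sup>2 = 1\<close>, which holds since the left-hand side has derivative zero.\<close>

lemma hyp_cosh_sinh_identity:
  "(hyp 0 t A o\<^sub>L hyp 0 t A) - (A o\<^sub>L (hyp 1 t A o\<^sub>L hyp 1 t A)) = id_blinfun"
proof -
  let ?g = "\<lambda>t. (hyp 0 t A o\<^sub>L hyp 0 t A) - (A o\<^sub>L (hyp 1 t A o\<^sub>L hyp 1 t A))"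
  have "(?g has_vector_derivative 0) (at t within UNIV)" for t
  proof -
    have 1: "((\<lambda>t. hyp 1 t A) has_vector_derivative hyp 0 t A) (at t)"
      using hyp_Suc_has_vector_derivative[of 0 A t] by simp
    have "(?g has_vector_derivative
        ((hyp 0 t A o\<^sub>L (A o\<^sub>L hyp 1 t A)) + ((A o\<^sub>L hyp 1 t A) o\<^sub>L hyp 0 t A)) -
        (A o\<^sub>L ((hyp 1 t A o\<^sub>L hyp 0 t A) + (hyp 0 t A o\<^sub>L hyp 1 t A)))) (at t)"
      by (intro has_vector_derivative_diff op_comp.has_vector_derivative 1
          bounded_linear.has_vector_derivative[OF op_comp.bounded_linear_right]
          hyp_0_has_vector_derivative)
    moreover have "hyp 0 t A o\<^sub>L (A o\<^sub>L hyp 1 t A) = A o\<^sub>L (hyp 0 t A o\<^sub>L hyp 1 t A)"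
      by (simp only: hyp_commute[of A 0 t] flip: op_comp_assoc)
    ultimately show ?thesis
      by (simp add: op_comp.add_right op_comp_assoc hyp_commute_hyp)
  qed
  then obtain c where c: "\<And>t. ?g t = c"
    using has_vector_derivative_zero_constant[of UNIV ?g] by auto
  from c[of 0] have "c = id_blinfun" by (simp add: hyp_at_0)
  with c show ?thesis by simp
qed

section \<open>Derivative of a determinant\<close>

text \<open>
  The Leibniz formula on an index set that is an arbitrary finite set: the index sets below are finite
  parts of an orthonormal basis and vary, so they cannot be types.
\<close>

definition leibniz_det :: "'i set \<Rightarrow> ('i \<Rightarrow> 'i \<Rightarrow> complex) \<Rightarrow> complex"
  where "leibniz_det F X = (\<Sum>p | p permutes F. of_int (sign p) * (\<Prod>e\<in>F. X e (p e)))"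

text \<open>Composing all permutations with the transposition of the two rows changes only the sign of the sum.\<close>

lemma leibniz_det_equal_rows:
  assumes F: "finite F" and ab: "a \<in> F" "b \<in> F" "a \<noteq> b" and X: "X a = X b"
  shows "leibniz_det F X = 0"
proof -
  let ?\<tau> = "Transposition.transpose a b"
  have \<tau>: "?\<tau> permutes F" using ab by (intro permutes_swap_id)
  have "leibniz_det F X = (\<Sum>p | p permutes F. of_int (sign (p \<circ> ?\<tau>)) * (\<Prod>e\<in>F. X e ((p \<circ> ?\<tau>) e)))"
    unfolding leibniz_det_def by (rule sum_permutations_compose_right[OF \<tau>])
  also have "\<dots> = (\<Sum>p | p permutes F. - (of_int (sign p) * (\<Prod>e\<in>F. X e (p e))))"
  proof (rule sum.cong[OF refl])
    fix p assume "p \<in> {p. p permutes F}"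
    then have p: "p permutes F" by simp
    have "sign (p \<circ> ?\<tau>) = - sign p"
      using ab F p \<tau> by (simp add: sign_compose sign_swap_id permutes_imp_permutation)
    moreover have "(\<Prod>e\<in>F. X e ((p \<circ> ?\<tau>) e)) = (\<Prod>e\<in>F. X (?\<tau> e) (p (?\<tau> e)))"
      using X by (intro prod.cong) (auto simp: Transposition.transpose_def)
    moreover have "\<dots> = (\<Prod>e\<in>F. X e (p e))"
      using prod.permute[OF \<tau>, of "\<lambda>e. X e (p e)"] by (simp add: o_def)
    ultimately show "of_int (sign (p \<circ> ?\<tau>)) * (\<Prod>e\<in>F. X e ((p \<circ> ?\<tau>) e))
        = - (of_int (sign p) * (\<Prod>e\<in>F. X e (p e)))"
      by simp
  qed
  also have "\<dots> = - leibniz_det F X"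
    by (simp add: leibniz_det_def sum_negf)
  finally show ?thesis by simp
qed

lemma leibniz_det_identity:
  assumes F: "finite F" and X: "\<And>e f. e \<in> F \<Longrightarrow> f \<in> F \<Longrightarrow> X e f = (if e = f then 1 else 0)"
  shows "leibniz_det F X = 1"
proof -
  have "(\<Prod>e\<in>F. X e (p e)) = (if p = id then 1 else 0)" if p: "p permutes F" for p
  proof (cases "p = id")
    case False
    then obtain e where "p e \<noteq> e" by (auto simp: fun_eq_iff)
    moreover from this p have "e \<in> F" by (auto simp: permutes_def)
    ultimately show ?thesis
      using F False X[of e "p e"] permutes_in_image[OF p] by (auto intro!: prod_zero bexI[of _ e])
  qed (use X in simp)
  then have "leibniz_det F X = (\<Sum>p | p permutes F. of_int (sign p) * (if p = id then 1 else 0))"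
    unfolding leibniz_det_def by (intro sum.cong) auto
  also have "\<dots> = (\<Sum>p | p permutes F. if p = id then 1 else 0)"
    by (intro sum.cong) auto
  also have "\<dots> = 1"
    using F finite_permutations[OF F] permutes_id[of F] by (simp add: sum.delta)
  finally show ?thesis .
qed

text \<open>
  The determinant is linear in row \<open>a\<close>, and the summands that put another row \<open>g\<close> in its place vanish.
\<close>

lemma leibniz_det_row_combination:
  assumes F: "finite F" and a: "a \<in> F"
  shows "leibniz_det F (X(a := (\<lambda>f. \<Sum>g\<in>F. z g * X g f))) = z a * leibniz_det F X"
proof -
  have split: "(\<Prod>e\<in>F. (X(a := r)) e (p e)) = r (p a) * (\<Prod>e\<in>F - {a}. X e (p e))" for r p
    using F a by (simp add: prod.remove[OF F a])
  have "leibniz_det F (X(a := (\<lambda>f. \<Sum>g\<in>F. z g * X g f)))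
      = (\<Sum>p | p permutes F. \<Sum>g\<in>F. z g * (of_int (sign p) * (\<Prod>e\<in>F. (X(a := X g)) e (p e))))"
    unfolding leibniz_det_def split
    by (simp add: sum_distrib_left sum_distrib_right mult_ac)
  also have "\<dots> = (\<Sum>g\<in>F. z g * leibniz_det F (X(a := X g)))"
    unfolding leibniz_det_def sum_distrib_left by (rule sum.swap)
  also have "\<dots> = (\<Sum>g\<in>F. if g = a then z a * leibniz_det F X else 0)"
  proof (rule sum.cong[OF refl])
    fix g assume g: "g \<in> F"
    have "leibniz_det F (X(a := X g)) = 0" if "g \<noteq> a"
      using leibniz_det_equal_rows[OF F a g, of "X(a := X g)"] that by simp
    then show "z g * leibniz_det F (X(a := X g)) = (if g = a then z a * leibniz_det F X else 0)"
      by simp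
  qed
  finally show ?thesis using F a by simp
qed

text \<open>
  Jacobi's formula for \<open>X' = Z X\<close>: by the product rule the derivative is the sum over \<open>e\<close> of the
  determinants in which row \<open>e\<close> is replaced by its derivative, a combination of the rows of \<open>X\<close>.
\<close>

lemma leibniz_det_has_vector_derivative:
  fixes X :: "real \<Rightarrow> 'i \<Rightarrow> 'i \<Rightarrow> complex"
  assumes F: "finite F"
    and X: "\<And>e f. e \<in> F \<Longrightarrow> f \<in> F \<Longrightarrow>
      ((\<lambda>t. X t e f) has_vector_derivative (\<Sum>g\<in>F. Z e g * X t g f)) (at t within S)"
  shows "((\<lambda>t. leibniz_det F (X t)) has_vector_derivative
    (\<Sum>e\<in>F. Z e e) * leibniz_det F (X t)) (at t within S)"
proof -
  define R where "R e = (X t)(e := (\<lambda>f. \<Sum>g\<in>F. Z e g * X t g f))" for e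
  \<comment> \<open>\<open>R e\<close> is the matrix with row \<open>e\<close> replaced by its derivative.\<close>
  have prod': "((\<lambda>t. \<Prod>e\<in>F. X t e (p e)) has_vector_derivative
      (\<Sum>e\<in>F. \<Prod>e'\<in>F. R e e' (p e'))) (at t within S)" if p: "p permutes F" for p
  proof -
    have "((\<lambda>t. \<Prod>e\<in>F. X t e (p e)) has_derivative
        (\<lambda>y. \<Sum>e\<in>F. (y *\<^sub>R (\<Sum>g\<in>F. Z e g * X t g (p e))) * (\<Prod>e'\<in>F - {e}. X t e' (p e'))))
        (at t within S)"
      using X permutes_in_image[OF p] unfolding has_vector_derivative_def
      by (intro has_derivative_prod) auto
    moreover have "y *\<^sub>R (\<Sum>e\<in>F. \<Prod>e'\<in>F. R e e' (p e'))
        = (\<Sum>e\<in>F. (y *\<^sub>R (\<Sum>g\<in>F. Z e g * X t g (p e))) * (\<Prod>e'\<in>F - {e}. X t e' (p e')))" for y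
      unfolding scaleR_sum_right[of y _ F, where f="\<lambda>e. \<Prod>e'\<in>F. R e e' (p e')"]
      by (rule sum.cong[OF refl]) (simp add: prod.remove[OF F] R_def)
    ultimately show ?thesis
      unfolding has_vector_derivative_def by presburger
  qed
  have "((\<lambda>t. leibniz_det F (X t)) has_vector_derivative
      (\<Sum>p | p permutes F. of_int (sign p) * (\<Sum>e\<in>F. \<Prod>e'\<in>F. R e e' (p e')))) (at t within S)"
    unfolding leibniz_det_def
    by (intro has_vector_derivative_sum has_vector_derivative_mult_right prod') simp
  moreover have "(\<Sum>p | p permutes F. of_int (sign p) * (\<Sum>e\<in>F. \<Prod>e'\<in>F. R e e' (p e')))
      = (\<Sum>e\<in>F. leibniz_det F (R e))"
    unfolding leibniz_det_def sum_distrib_left by (rule sum.swap)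
  moreover have "\<dots> = (\<Sum>e\<in>F. Z e e * leibniz_det F (X t))"
    unfolding R_def by (intro sum.cong refl leibniz_det_row_combination[OF F])
  ultimately show ?thesis by (simp add: sum_distrib_right)
qed

section \<open>Hilbert space geometry\<close>

text \<open>
  A relational form of the adjoint: explicit adjoints of the operators at hand are known, so the
  existence theorem for adjoints can be bypassed.
\<close>

definition adjoint_pair :: "('a \<Rightarrow> 'a \<Rightarrow> complex) \<Rightarrow> 'a::real_normed_vector operator \<Rightarrow> 'a operator \<Rightarrow> bool"
  where "adjoint_pair ip T S \<longleftrightarrow> (\<forall>x y. ip (T x) y = ip x (S y))"

lemma symmetric_op_iff_adjoint_pair: "symmetric_op ip T \<longleftrightarrow> adjoint_pair ip T T"
  by (simp add: symmetric_op_def adjoint_pair_def)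

lemma adjoint_pair_comp:
  "adjoint_pair ip S S' \<Longrightarrow> adjoint_pair ip T T' \<Longrightarrow> adjoint_pair ip (S o\<^sub>L T) (T' o\<^sub>L S')"
  by (simp add: adjoint_pair_def)

lemma adjoint_pair_inverse_pair:
  assumes adj: "adjoint_pair ip T T'" and "inverse_pair T S" "inverse_pair T' S'"
  shows "adjoint_pair ip S S'"
  unfolding adjoint_pair_def
proof (intro allI)
  fix x y
  have id: "T (S x) = x" "T' (S' y) = y"
    using assms(2,3) by (simp_all add: inverse_pair_apply)
  have "ip (S x) y = ip (S x) (T' (S' y))" by (simp add: id)
  also have "\<dots> = ip (T (S x)) (S' y)" using adj by (simp add: adjoint_pair_def)
  finally show "ip (S x) y = ip x (S' y)" by (simp add: id)
qed

lemma linear_over_id: "linear_over K scl id_blinfun"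
  by (simp add: linear_over_def)

lemma linear_over_comp: "linear_over K scl S \<Longrightarrow> linear_over K scl T \<Longrightarrow> linear_over K scl (S o\<^sub>L T)"
  by (simp add: linear_over_def)

lemma linear_over_add:
  "\<forall>c\<in>K. bounded_linear (scl c) \<Longrightarrow> linear_over K scl S \<Longrightarrow> linear_over K scl T \<Longrightarrow> linear_over K scl (S + T)"
  by (simp add: linear_over_def blinfun.add_left linear_simps)

lemma linear_over_power_op: "linear_over K scl T \<Longrightarrow> linear_over K scl (power_op T n)"
  by (induction n) (auto intro: linear_over_id linear_over_comp simp del: id_op_comp)

lemma linear_over_inverse_pair:
  assumes T: "linear_over K scl T" and "inverse_pair T S"
  shows "linear_over K scl S"
  unfolding linear_over_def
proof (intro ballI allI)
  fix c x assume c: "c \<in> K"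
  note id = inverse_pair_apply[OF assms(2)]
  have "S (scl c x) = S (scl c (T (S x)))" by (simp add: id)
  also have "\<dots> = S (T (scl c (S x)))" using T c by (simp add: linear_over_def)
  finally show "S (scl c x) = scl c (S x)" by (simp add: id)
qed

context hilbert_space
begin

lemma of_real_in_scalars [simp]: "complex_of_real r \<in> K"
  using scalars by auto

lemma cnj_in_scalars: "c \<in> K \<Longrightarrow> cnj c \<in> K"
  using scalars by (auto simp: Reals_cnj_iff)

lemma ip_scaleR_right: "ip x (r *\<^sub>R y) = r *\<^sub>R ip x y"
  using ip_scl_right[of "of_real r" x y] by (simp add: scl_of_real scaleR_conv_of_real)

lemma ip_add_left: "ip (x + y) z = ip x z + ip y z"
  by (metis ip_cnj ip_add_right complex_cnj_add)

lemma ip_scaleR_left: "ip (r *\<^sub>R x) y = r *\<^sub>R ip x y"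
  by (metis ip_cnj ip_scaleR_right complex_cnj_scaleR)

lemma ip_scl_left: "c \<in> K \<Longrightarrow> ip (scl c x) y = cnj c * ip x y"
  by (metis ip_cnj ip_scl_right complex_cnj_mult)

lemma Re_ip_commute: "Re (ip x y) = Re (ip y x)"
  by (metis ip_cnj cnj.simps(1))

lemma Re_ip_self: "Re (ip x x) = (norm x)\<^sup>2"
  by (simp add: ip_self)

lemma norm_scl: 
  assumes c: "c \<in> K"
  shows "norm (scl c x) = norm c * norm x"
proof -
  have "ip (scl c x) (scl c x) = cnj c * (c * ip x x)"
    using c by (simp add: ip_scl_left ip_scl_right)
  from arg_cong[OF this, of norm] have "(norm (scl c x))\<^sup>2 = (norm c * norm x)\<^sup>2"
    by (simp add: ip_self norm_mult norm_power power2_eq_square)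
  then show ?thesis by (simp add: power2_eq_iff_nonneg)
qed

text \<open>
  The Cauchy-Schwarz inequality for the real part of the semi-inner product \<open>(x, y) \<mapsto> \<langle>x, Yy\<rangle>\<close>, from the
  discriminant of \<open>r \<mapsto> \<langle>x + ry, Y(x + ry)\<rangle>\<close>. Using real \<open>r\<close> only treats both scalar fields alike.
\<close>

lemma cauchy_schwarz_semidefinite:
  fixes Y :: "'a operator"
  assumes sym: "symmetric_op ip Y" and nonneg: "\<And>x. 0 \<le> Re (ip x (Y x))"
  shows "(Re (ip x (Y y)))\<^sup>2 \<le> Re (ip x (Y x)) * Re (ip y (Y y))"
proof -
  let ?a = "Re (ip y (Y y))" and ?b = "Re (ip x (Y y))" and ?c = "Re (ip x (Y x))"
  have yx: "Re (ip y (Y x)) = ?b"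
    using sym Re_ip_commute[of y "Y x"] by (simp add: symmetric_op_def)
  have quad: "0 \<le> ?c + 2 * r * ?b + r\<^sup>2 * ?a" for r
    using nonneg[of "x + r *\<^sub>R y"]
    by (simp add: blinfun.add_right blinfun.scaleR_right ip_add_left ip_add_right ip_scaleR_left
        ip_scaleR_right yx power2_eq_square algebra_simps)
  show ?thesis
  proof (cases "?a = 0")
    case True
    have "?b = 0"
    proof (rule ccontr)
      assume "?b \<noteq> 0"
      then show False using quad[of "- (?c + 1) / (2 * ?b)"] True by (simp add: field_simps)
    qed
    then show ?thesis using True by simp
  next
    case False
    with nonneg[of y] have "?a > 0" by simp
    then show ?thesis
      using quad[of "- ?b / ?a"] by (simp add: power2_eq_square field_simps)
  qed
qed

text \<open>
  The modulus of \<open>\<langle>x, y\<rangle>\<close> is recovered from the real part by rotating \<open>y\<close> with the scalar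
  \<open>cnj \<langle>x, y\<rangle>\<close>, which lies in the scalar field.
\<close>

lemma norm_ip_le: "norm (ip x y) \<le> norm x * norm y"
proof -
  have re: "Re (ip x z) \<le> norm x * norm z" for z
  proof -
    have "(Re (ip x z))\<^sup>2 \<le> (norm x * norm z)\<^sup>2"
      using cauchy_schwarz_semidefinite[of id_blinfun x z]
      by (simp add: symmetric_op_def Re_ip_self power_mult_distrib)
    then show ?thesis by (rule power2_le_imp_le) simp
  qed
  let ?c = "cnj (ip x y)"
  have c: "?c \<in> K" by (simp add: ip_in_scalars cnj_in_scalars)
  have "(norm (ip x y))\<^sup>2 = Re (ip x (scl ?c y))"
    using c by (simp add: ip_scl_right cmod_power2) (simp add: power2_eq_square)
  also have "\<dots> \<le> norm x * (norm (ip x y) * norm y)"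
    using re[of "scl ?c y"] by (simp add: norm_scl[OF c])
  finally have "norm (ip x y) * norm (ip x y) \<le> norm (ip x y) * (norm x * norm y)"
    by (simp add: power2_eq_square mult_ac)
  then show ?thesis by (cases "ip x y = 0") auto
qed

sublocale ip: bounded_bilinear ip
  by unfold_locales
    (auto simp: ip_add_left ip_add_right ip_scaleR_left ip_scaleR_right
      intro!: exI[of _ 1] norm_ip_le)

lemma ip_left_cancel: "(\<And>x. ip x y = ip x z) \<Longrightarrow> y = z"
  using Re_ip_self[of "y - z"] by (simp add: ip.diff_right)

lemma adjoint_op_eq: 
  assumes "adjoint_pair ip T S"
  shows "adjoint_op ip T = S"
  unfolding adjoint_op_def
proof (rule the_equality)
  show "\<forall>x y. ip (T x) y = ip x (S y)" using assms by (simp add: adjoint_pair_def)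
  fix S' :: "'a operator" assume S': "\<forall>x y. ip (T x) y = ip x (S' y)"
  show "S' = S"
  proof (rule blinfun_eqI, rule ip_left_cancel)
    fix x y show "ip x (S' y) = ip x (S y)"
      using S' assms by (metis adjoint_pair_def)
  qed
qed

lemma adjoint_op_0: "adjoint_op ip 0 = 0"
  by (rule adjoint_op_eq) (simp add: adjoint_pair_def ip.zero_left ip.zero_right)

lemma scl_scaleR_right: "c \<in> K \<Longrightarrow> scl c (r *\<^sub>R x) = r *\<^sub>R scl c x"
  using scl_scl[of c "of_real r" x] scl_scl[of "of_real r" c x]
  by (simp add: scl_of_real mult.commute)

lemma bounded_linear_scl: "c \<in> K \<Longrightarrow> bounded_linear (scl c)"
  by (rule bounded_linear_intro[of _ "norm c"])
    (auto simp: scl_add_right scl_scaleR_right norm_scl)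

lemma linear_over_hyp:
  assumes A: "linear_over K scl A"
  shows "linear_over K scl (hyp j t A)"
  unfolding linear_over_def
proof (intro ballI allI)
  fix c x assume c: "c \<in> K"
  have "(\<lambda>n. hyp_coeff j t n *\<^sub>R power_op A n (scl c x)) sums scl c (hyp j t A x)"
    using bounded_linear.sums[OF bounded_linear_scl[OF c] hyp_apply_sums[of j t A x]]
      linear_over_power_op[OF A] c
    by (simp add: scl_scaleR_right linear_over_def)
  then show "hyp j t A (scl c x) = scl c (hyp j t A x)"
    by (rule sums_unique2[OF hyp_apply_sums])
qed

lemma adjoint_pair_power_op:
  assumes "adjoint_pair ip A A'"
  shows "adjoint_pair ip (power_op A n) (power_op A' n)"
proof (induction n)
  case (Suc n)
  have "power_op A' n o\<^sub>L A' = power_op A' (Suc n)"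
    using power_op_intertwine[of A' A' A' n] by simp
  with adjoint_pair_comp[OF assms Suc] show ?case by simp
qed (simp add: adjoint_pair_def)

lemma adjoint_pair_hyp:
  assumes "adjoint_pair ip A A'"
  shows "adjoint_pair ip (hyp j t A) (hyp j t A')"
  unfolding adjoint_pair_def
proof (intro allI)
  fix x y
  have "(\<lambda>n. ip (hyp_coeff j t n *\<^sub>R power_op A n x) y) sums ip (hyp j t A x) y"
    by (rule bounded_linear.sums[OF ip.bounded_linear_left hyp_apply_sums])
  moreover have "(\<lambda>n. ip x (hyp_coeff j t n *\<^sub>R power_op A' n y)) sums ip x (hyp j t A' y)"
    by (rule bounded_linear.sums[OF ip.bounded_linear_right hyp_apply_sums])
  moreover have "ip (hyp_coeff j t n *\<^sub>R power_op A n x) y = ip x (hyp_coeff j t n *\<^sub>R power_op A' n y)" for n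
    using adjoint_pair_power_op[OF assms] by (simp add: ip_scaleR_left ip_scaleR_right adjoint_pair_def)
  ultimately show "ip (hyp j t A x) y = ip x (hyp j t A' y)"
    by (simp add: sums_unique2)
qed

section \<open>Products of nonnegative operators\<close>

text \<open>
  Put \<open>y = x + XYx\<close> and \<open>q(z) = \<langle>z, Yz\<rangle>\<close>. Since \<open>\<langle>Yx, XYx\<rangle> \<ge> 0\<close>, pairing \<open>y\<close> with \<open>Yx\<close> and the
  Cauchy-Schwarz inequality for \<open>q\<close> give \<open>q(x) \<le> q(y)\<close>. A second use of that inequality bounds
  \<open>\<parallel>Yx\<parallel>\<^sup>2\<close> by \<open>\<parallel>Y\<parallel> q(x)\<close>, so \<open>\<parallel>Yx\<parallel> \<le> \<parallel>Y\<parallel> \<parallel>y\<parallel>\<close>, and \<open>x = y - XYx\<close>.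
\<close>

lemma bounded_below_id_plus_comp:
  fixes X Y :: "'a operator"
  assumes Y: "symmetric_op ip Y" "\<And>x. 0 \<le> Re (ip x (Y x))"
    and X: "\<And>x. 0 \<le> Re (ip x (X x))"
  shows "norm x \<le> (1 + norm X * norm Y) * norm (x + X (Y x))"
proof -
  let ?y = "x + X (Y x)" and ?q = "\<lambda>x. Re (ip x (Y x))"
  have q_le: "?q z \<le> norm Y * (norm z)\<^sup>2" for z
  proof -
    have "?q z \<le> norm (ip z (Y z))" by (rule complex_Re_le_cmod)
    also have "\<dots> \<le> norm z * norm (Y z)" by (rule norm_ip_le)
    also have "\<dots> \<le> norm z * (norm Y * norm z)" by (intro mult_left_mono norm_blinfun) simp
    finally show ?thesis by (simp add: power2_eq_square mult_ac)
  qed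
  have "?q x \<le> ?q ?y"
  proof -
    have "?q x \<le> Re (ip x (Y x)) + Re (ip (Y x) (X (Y x)))"
      using X by simp
    also have "\<dots> = Re (ip x (Y ?y))"
      using Y(1) by (simp add: blinfun.add_right ip_add_right symmetric_op_def)
    finally have "(?q x)\<^sup>2 \<le> (Re (ip x (Y ?y)))\<^sup>2"
      using Y(2)[of x] by (intro power_mono)
    also have "\<dots> \<le> ?q x * ?q ?y"
      by (rule cauchy_schwarz_semidefinite[OF Y])
    finally have "?q x * ?q x \<le> ?q x * ?q ?y" by (simp add: power2_eq_square)
    then show ?thesis using Y(2)[of x] Y(2)[of ?y] by (cases "?q x = 0") auto
  qed
  have "norm (Y x) \<le> norm Y * norm ?y"
  proof (cases "Y x = 0")
    case False
    have "(norm (Y x))\<^sup>2 = Re (ip x (Y (Y x)))"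
      using Y(1) by (simp add: symmetric_op_def flip: Re_ip_self)
    then have "((norm (Y x))\<^sup>2)\<^sup>2 \<le> ?q x * ?q (Y x)"
      using cauchy_schwarz_semidefinite[OF Y, of x "Y x"] by simp
    also have "\<dots> \<le> (norm Y * (norm ?y)\<^sup>2) * (norm Y * (norm (Y x))\<^sup>2)"
      using order_trans[OF \<open>?q x \<le> ?q ?y\<close> q_le] by (intro mult_mono q_le) (auto simp: Y(2))
    finally have "(norm (Y x))\<^sup>2 * (norm (Y x))\<^sup>2 \<le> (norm Y * norm ?y)\<^sup>2 * (norm (Y x))\<^sup>2"
      by (simp add: power2_eq_square mult_ac)
    then have "(norm (Y x))\<^sup>2 \<le> (norm Y * norm ?y)\<^sup>2"
      by (rule mult_right_le_imp_le) (simp add: False)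
    then show ?thesis by (rule power2_le_imp_le) simp
  qed simp
  then have "norm (X (Y x)) \<le> norm X * (norm Y * norm ?y)"
    by (rule order_trans[OF norm_blinfun mult_left_mono[OF _ norm_ge_zero]])
  moreover have "norm x \<le> norm ?y + norm (X (Y x))"
    using norm_triangle_sub[of x ?y] by simp
  ultimately show ?thesis by (simp add: algebra_simps)
qed

text \<open>
  The method of continuity: the lower bound gives one bound for the inverses of all \<open>I + \<tau> X Y\<close>,
  \<open>0 \<le> \<tau> \<le> 1\<close>, hence one admissible step width for the perturbation lemma, and finitely many steps lead from
  \<open>\<tau> = 0\<close> to \<open>\<tau> = 1\<close>.
\<close>

lemma inverse_pair_id_plus_comp:
  fixes X Y :: "'a operator"
  assumes Y: "symmetric_op ip Y" "\<And>x. 0 \<le> Re (ip x (Y x))"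
    and X: "\<And>x. 0 \<le> Re (ip x (X x))"
  obtains S where "inverse_pair (id_blinfun + (X o\<^sub>L Y)) S" "norm S \<le> 1 + norm X * norm Y"
proof -
  let ?k = "1 + norm X * norm Y"
  let ?T = "\<lambda>\<tau>. id_blinfun + (\<tau> *\<^sub>R X o\<^sub>L Y)"
  have k: "?k \<ge> 1" by simp
  have inv_le: "norm S \<le> ?k" if "inverse_pair (?T \<tau>) S" "0 \<le> \<tau>" "\<tau> \<le> 1" for \<tau> S
  proof (rule norm_blinfun_bound)
    fix y
    have "?T \<tau> (S y) = y"
      by (rule inverse_pair_apply(1)[OF that(1)])
    then have "norm (S y) \<le> (1 + norm (\<tau> *\<^sub>R X) * norm Y) * norm y"
      using bounded_below_id_plus_comp[OF Y, of "\<tau> *\<^sub>R X" "S y"] X that(2)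
      by (simp add: blinfun.add_left blinfun.scaleR_left ip_scaleR_right)
    also have "\<dots> \<le> ?k * norm y"
      using that(2,3) by (intro mult_right_mono) (auto simp: mult_left_le_one_le mult.assoc)
    finally show "norm (S y) \<le> ?k * norm y" .
  qed (use k in simp)
  \<comment> \<open>With \<open>N\<close> steps of equal width the perturbation hypothesis holds at each step.\<close>
  obtain M :: nat where M: "norm (X o\<^sub>L Y) * ?k * 2 \<le> real M"
    using real_arch_simple by blast
  define N where "N = Suc M"
  have N: "N > 0" "norm (X o\<^sub>L Y) * ?k * 2 \<le> real N"
    using M by (simp_all add: N_def)
  have "\<exists>S. inverse_pair (?T (real n / real N)) S" if "n \<le> N" for n
    using that
  proof (induction n)
    case 0
    show ?case by (intro exI[of _ id_blinfun]) (simp add: inverse_pair_def op_comp.zero_left)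
  next
    case (Suc n)
    then obtain S where S: "inverse_pair (?T (real n / real N)) S" by auto
    have S_le: "norm S \<le> ?k" using S Suc.prems by (intro inv_le) auto
    have "?T (real (Suc n) / real N) - ?T (real n / real N) = (1 / real N) *\<^sub>R (X o\<^sub>L Y)"
      by (simp add: op_comp.scaleR_left op_comp.add_left add_divide_distrib scaleR_add_left)
    then have "norm (?T (real (Suc n) / real N) - ?T (real n / real N)) * ?k \<le> 1/2"
      using N by (simp add: field_simps)
    from inverse_pair_perturb[OF S S_le this] show ?case by blast
  qed
  from this[of N] N obtain S where "inverse_pair (?T 1) S" by auto
  with inv_le[of 1 S] that show thesis by simp
qed

text \<open>
  \<open>C (BC)\<^sup>n\<^sup>+\<^sup>2 = (BC)\<^sup>* (C (BC)\<^sup>n) (BC)\<close> reduces the claim to the nonnegative operators \<open>C\<close> and \<open>C B C\<close>.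
\<close>

lemma Re_ip_sandwich_nonneg:
  fixes B C :: "'a operator"
  assumes B: "symmetric_op ip B" "\<And>x. 0 \<le> Re (ip x (B x))"
    and C: "symmetric_op ip C" "\<And>x. 0 \<le> Re (ip x (C x))"
  shows "0 \<le> Re (ip x (C (power_op (B o\<^sub>L C) n x)))"
proof (induction n arbitrary: x rule: less_induct)
  case (less n)
  have comm: "power_op (B o\<^sub>L C) m (B (C y)) = B (C (power_op (B o\<^sub>L C) m y))" for m y
    using arg_cong[OF power_op_intertwine[of "B o\<^sub>L C" "B o\<^sub>L C" "B o\<^sub>L C" m], of "\<lambda>T. T y"]
    by simp
  consider "n = 0" | "n = 1" | m where "n = Suc (Suc m)"
    by (metis One_nat_def not0_implies_Suc)
  then show ?case
  proof cases
    case 1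
    then show ?thesis using C by simp
  next
    case 2
    then show ?thesis using B(2)[of "C x"] C(1) by (simp add: symmetric_op_def)
  next
    case (3 m)
    have "ip x (C (power_op (B o\<^sub>L C) n x)) = ip (B (C x)) (C (power_op (B o\<^sub>L C) m (B (C x))))"
      using B(1) C(1) by (simp add: 3 comm symmetric_op_def)
    then show ?thesis using less[of m "B (C x)"] 3 by simp
  qed
qed

lemma sandwich_hyp:
  fixes B C :: "'a operator"
  assumes B: "symmetric_op ip B" "\<And>x. 0 \<le> Re (ip x (B x))"
    and C: "symmetric_op ip C" "\<And>x. 0 \<le> Re (ip x (C x))"
    and t: "t \<ge> 0"
  shows "symmetric_op ip (C o\<^sub>L hyp j t (B o\<^sub>L C))" "0 \<le> Re (ip x ((C o\<^sub>L hyp j t (B o\<^sub>L C)) x))"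
proof -
  have adj: "adjoint_pair ip (B o\<^sub>L C) (C o\<^sub>L B)"
    using B(1) C(1) by (auto simp: symmetric_op_iff_adjoint_pair intro: adjoint_pair_comp)
  have "C o\<^sub>L hyp j t (B o\<^sub>L C) = hyp j t (C o\<^sub>L B) o\<^sub>L C"
    by (rule hyp_intertwine) (simp add: op_comp_assoc)
  then show "symmetric_op ip (C o\<^sub>L hyp j t (B o\<^sub>L C))"
    using adjoint_pair_comp[OF _ adjoint_pair_hyp[OF adj], of C C j t] C(1)
    by (simp add: symmetric_op_iff_adjoint_pair)
  have lim: "(\<lambda>n. Re (ip x (C (hyp_coeff j t n *\<^sub>R power_op (B o\<^sub>L C) n x))))
      sums Re (ip x (C (hyp j t (B o\<^sub>L C) x)))"
    by (intro sums_Re bounded_linear.sums[OF ip.bounded_linear_right]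
        bounded_linear.sums[OF blinfun.bounded_linear_right] hyp_apply_sums)
  have "0 \<le> Re (ip x (C (hyp_coeff j t n *\<^sub>R power_op (B o\<^sub>L C) n x)))" for n
    using Re_ip_sandwich_nonneg[OF B C, of x n] t
    by (simp add: blinfun.scaleR_right ip_scaleR_right hyp_coeff_def)
  then have "0 \<le> Re (ip x (C (hyp j t (B o\<^sub>L C) x)))"
    by (rule sums_le[OF _ sums_zero lim])
  then show "0 \<le> Re (ip x ((C o\<^sub>L hyp j t (B o\<^sub>L C)) x))" by simp
qed

section \<open>Orthonormal bases\<close>

definition orthonormal :: "'a set \<Rightarrow> bool"
  where "orthonormal E \<longleftrightarrow> (\<forall>e\<in>E. \<forall>f\<in>E. ip e f = (if e = f then 1 else 0))"

lemma orthonormal_subset: "orthonormal E \<Longrightarrow> F \<subseteq> E \<Longrightarrow> orthonormal F"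
  unfolding orthonormal_def by blast

text \<open>
  Limits along an orthonormal basis are selected by definite descriptions that range over all bases, so
  at least one basis is needed for their uniqueness. A maximal orthonormal set is one.
\<close>

lemma orthonormal_basis_exists: "\<exists>E. orthonormal_basis ip E"
proof -
  have "\<exists>M\<in>Collect orthonormal. \<forall>X\<in>Collect orthonormal. M \<subseteq> X \<longrightarrow> X = M"
  proof (rule subset_Zorn')
    fix \<C> assume chain: "subset.chain (Collect orthonormal) \<C>"
    have "ip e f = (if e = f then 1 else 0)" if "e \<in> \<Union>\<C>" "f \<in> \<Union>\<C>" for e f
    proof -
      obtain X Y where XY: "X \<in> \<C>" "Y \<in> \<C>" "e \<in> X" "f \<in> Y" using \<open>e \<in> \<Union>\<C>\<close> \<open>f \<in> \<Union>\<C>\<close> by blast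
      then have "X \<subseteq> Y \<or> Y \<subseteq> X" using chain by (auto simp: subset.chain_def)
      then obtain Z where "Z \<in> \<C>" "e \<in> Z" "f \<in> Z" using XY by blast
      then show ?thesis using chain by (auto simp: subset.chain_def orthonormal_def)
    qed
    then show "\<Union>\<C> \<in> Collect orthonormal" by (simp add: orthonormal_def)
  qed
  then obtain M where M: "orthonormal M" and max: "\<And>X. orthonormal X \<Longrightarrow> M \<subseteq> X \<Longrightarrow> X = M"
    by auto
  have "x = 0" if x: "\<forall>e\<in>M. ip e x = 0" for x
  proof (rule ccontr)
    assume "x \<noteq> 0"
    define u where "u = x /\<^sub>R norm x"
    have eu: "ip e u = 0" "ip u e = 0" if "e \<in> M" for e
    proof -
      show "ip e u = 0" using x that by (simp add: u_def ip_scaleR_right)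
      then show "ip u e = 0" using ip_cnj[of u e] by simp
    qed
    have uu: "ip u u = 1" using \<open>x \<noteq> 0\<close> by (simp add: ip_self u_def)
    have "orthonormal (insert u M)"
      using M eu uu by (auto simp: orthonormal_def)
    then have "insert u M = M" by (rule max) auto
    then show False using eu(1)[of u] uu by auto
  qed
  then have "\<forall>x. (\<forall>e\<in>M. ip e x = 0) \<longrightarrow> x = 0" by (intro allI impI)
  with M have "orthonormal_basis ip M"
    unfolding orthonormal_basis_def orthonormal_def by (rule conjI)
  then show ?thesis ..
qed

lemma orthonormal_basisD: "orthonormal_basis ip E \<Longrightarrow> orthonormal E"
  by (simp add: orthonormal_basis_def orthonormal_def)

definition proj :: "'a set \<Rightarrow> 'a operator"
  where "proj F = Blinfun (\<lambda>x. \<Sum>e\<in>F. scl (ip e x) e)"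

lemma proj_apply: "proj F x = (\<Sum>e\<in>F. scl (ip e x) e)"
proof -
  have "bounded_linear (\<lambda>x. scl (ip e x) e)" for e
  proof (rule bounded_linear_intro[of _ "norm e * norm e"])
    show "scl (ip e (x + y)) e = scl (ip e x) e + scl (ip e y) e" for x y
      by (simp add: ip_add_right scl_add_left ip_in_scalars)
    show "scl (ip e (r *\<^sub>R x)) e = r *\<^sub>R scl (ip e x) e" for r x
      using scl_scl[of "of_real r" "ip e x" e]
      by (simp add: ip_scaleR_right scl_of_real ip_in_scalars scaleR_conv_of_real)
    show "norm (scl (ip e x) e) \<le> norm x * (norm e * norm e)" for x
      using mult_right_mono[OF norm_ip_le[of e x], of "norm e"]
      by (simp add: norm_scl ip_in_scalars mult_ac)
  qed
  then have "bounded_linear (\<lambda>x. \<Sum>e\<in>F. scl (ip e x) e)"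
    by (intro bounded_linear_sum)
  then show ?thesis by (simp add: proj_def bounded_linear_Blinfun_apply)
qed

lemma linear_over_proj_apply:
  assumes "linear_over K scl T"
  shows "T (proj F x) = (\<Sum>e\<in>F. scl (ip e x) (T e))"
  using assms by (simp add: proj_apply linear_over_def ip_in_scalars blinfun.sum_right)

lemma linear_over_proj: "linear_over K scl (proj F)"
  by (simp add: linear_over_def proj_apply ip_scl_right scl_scl ip_in_scalars
      linear_sum[OF bounded_linear.linear[OF bounded_linear_scl]])

lemma ip_proj_left: "ip (proj F x) y = (\<Sum>e\<in>F. cnj (ip e x) * ip e y)"
  by (simp add: proj_apply ip.sum_left ip_scl_left ip_in_scalars)

lemma adjoint_pair_proj: "adjoint_pair ip (proj F) (proj F)"
  unfolding adjoint_pair_def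
proof (intro allI)
  fix x y
  have "ip x (proj F y) = (\<Sum>e\<in>F. ip e y * ip x e)"
    by (simp add: proj_apply ip.sum_right ip_scl_right ip_in_scalars)
  also have "\<dots> = ip (proj F x) y"
    unfolding ip_proj_left by (intro sum.cong refl) (metis ip_cnj mult.commute)
  finally show "ip (proj F x) y = ip x (proj F y)" by simp
qed

context
  fixes F :: "'a set"
  assumes F: "finite F" "orthonormal F"
begin

lemma ip_proj_right:
  assumes "e \<in> F"
  shows "ip e (proj F x) = ip e x"
proof -
  have "ip e (proj F x) = (\<Sum>f\<in>F. ip f x * ip e f)"
    by (simp add: proj_apply ip.sum_right ip_scl_right ip_in_scalars)
  also have "\<dots> = (\<Sum>f\<in>F. if f = e then ip e x else 0)"
    using F assms by (intro sum.cong) (auto simp: orthonormal_def)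
  finally show ?thesis using F assms by simp
qed

lemma proj_in:
  assumes "f \<in> F"
  shows "proj F f = f"
proof -
  have "proj F f = (\<Sum>e\<in>F. if e = f then scl 1 f else 0)"
    unfolding proj_apply using F assms scl_of_real[of 0] by (intro sum.cong) (auto simp: orthonormal_def)
  then show ?thesis using F assms scl_of_real[of 1 f] by simp
qed

lemma norm_proj_sq: "(norm (proj F x))\<^sup>2 = (\<Sum>e\<in>F. (norm (ip e x))\<^sup>2)"
proof -
  have "ip (proj F x) (proj F x) = (\<Sum>e\<in>F. complex_of_real ((norm (ip e x))\<^sup>2))"
    unfolding ip_proj_left
    by (intro sum.cong refl) (simp add: ip_proj_right complex_norm_square mult.commute del: of_real_power)
  then have "complex_of_real ((norm (proj F x))\<^sup>2) = complex_of_real (\<Sum>e\<in>F. (norm (ip e x))\<^sup>2)"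
    by (simp only: ip_self of_real_sum)
  then show ?thesis by (simp only: of_real_eq_iff)
qed

lemma Re_ip_proj: "Re (ip (proj F x) x) = (norm (proj F x))\<^sup>2"
proof -
  have "ip (proj F x) x = ip (proj F x) (proj F x)"
    unfolding ip_proj_left by (intro sum.cong refl) (simp add: ip_proj_right)
  then show ?thesis by (simp add: Re_ip_self)
qed

lemma norm_proj_apply_le: "norm (proj F x) \<le> norm x"
proof -
  have "norm (proj F x) * norm (proj F x) \<le> norm (proj F x) * norm x"
    using Re_ip_proj[of x] complex_Re_le_cmod[of "ip (proj F x) x"] norm_ip_le[of "proj F x" x]
    by (simp add: power2_eq_square)
  then show ?thesis by (cases "proj F x = 0") auto
qed

lemma norm_proj_le: "norm (proj F) \<le> 1"
  using norm_proj_apply_le by (intro norm_blinfun_bound) auto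

lemma norm_proj_diff_le: "norm (proj F x - x) \<le> norm x"
proof -
  have "(norm (proj F x - x))\<^sup>2 = (norm x)\<^sup>2 - (norm (proj F x))\<^sup>2"
    using Re_ip_proj[of x] Re_ip_commute[of x "proj F x"]
    by (simp add: ip.diff_left ip.diff_right Re_ip_self flip: Re_ip_self[of "proj F x - x"])
  then have "(norm (proj F x - x))\<^sup>2 \<le> (norm x)\<^sup>2" by simp
  then show ?thesis by (rule power2_le_imp_le) simp
qed

end

text \<open>
  By Bessel's inequality the projections form a Cauchy net; the difference between \<open>x\<close> and its
  limit is orthogonal to the basis.
\<close>

lemma proj_tendsto:
  assumes E: "orthonormal_basis ip E"
  shows "((\<lambda>F. proj F x) \<longlongrightarrow> x) (finite_subsets_at_top E)"
proof -
  let ?f = "\<lambda>e. (norm (ip e x))\<^sup>2"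
  note on = orthonormal_subset[OF orthonormal_basisD[OF E]]
  have "?f summable_on E"
  proof (rule nonneg_bdd_above_summable_on)
    show "bdd_above (sum ?f ` {F. F \<subseteq> E \<and> finite F})"
    proof (rule bdd_aboveI2)
      fix F assume "F \<in> {F. F \<subseteq> E \<and> finite F}"
      then have F: "finite F" "orthonormal F" using on by auto
      show "sum ?f F \<le> (norm x)\<^sup>2"
        using norm_proj_apply_le[OF F, of x] by (simp add: power_mono flip: norm_proj_sq[OF F])
    qed
  qed simp
  then have lim: "(sum ?f \<longlongrightarrow> infsum ?f E) (finite_subsets_at_top E)"
    by (simp add: infsum_tendsto)
  have "cauchy_filter (filtermap (\<lambda>F. proj F x) (finite_subsets_at_top E))"
    unfolding cauchy_filter_metric_filtermap
  proof (intro allI impI)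
    fix \<epsilon> :: real assume \<epsilon>: "\<epsilon> > 0"
    have "\<forall>\<^sub>F F in finite_subsets_at_top E. dist (sum ?f F) (infsum ?f E) < \<epsilon>\<^sup>2 / 8"
      by (rule tendstoD[OF lim]) (use \<epsilon> in simp)
    then obtain F0 where "finite F0 \<and> F0 \<subseteq> E \<and>
        (\<forall>F. finite F \<and> F0 \<subseteq> F \<and> F \<subseteq> E \<longrightarrow> dist (sum ?f F) (infsum ?f E) < \<epsilon>\<^sup>2 / 8)"
      unfolding eventually_finite_subsets_at_top ..
    then have F0: "finite F0" "F0 \<subseteq> E"
      and near: "\<And>F. finite F \<Longrightarrow> F0 \<subseteq> F \<Longrightarrow> F \<subseteq> E \<Longrightarrow> dist (sum ?f F) (infsum ?f E) < \<epsilon>\<^sup>2 / 8"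
      by simp_all
    define P where "P F \<longleftrightarrow> finite F \<and> F0 \<subseteq> F \<and> F \<subseteq> E" for F
    have half: "dist (proj F x) (proj F0 x) < \<epsilon> / 2" if "P F" for F
    proof -
      have F: "finite F" "F0 \<subseteq> F" "F \<subseteq> E" using that by (auto simp: P_def)
      have D: "finite (F - F0)" "orthonormal (F - F0)" using F on[of "F - F0"] by auto
      have "proj F x - proj F0 x = proj (F - F0) x"
        using sum_diff[OF F(1,2), of "\<lambda>e. scl (ip e x) e"] by (simp add: proj_apply)
      then have "(norm (proj F x - proj F0 x))\<^sup>2 = sum ?f F - sum ?f F0"
        using sum_diff[OF F(1,2), of ?f] by (simp add: norm_proj_sq[OF D])
      also have "\<dots> < \<epsilon>\<^sup>2 / 4"
        using near[OF F] near[OF F0(1) order_refl F0(2)]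
        unfolding dist_real_def abs_less_iff by linarith
      also have "\<dots> = (\<epsilon> / 2)\<^sup>2"
        by (simp add: power_divide)
      finally have "norm (proj F x - proj F0 x) < \<epsilon> / 2"
        by (rule power2_less_imp_less) (use \<epsilon> in simp)
      then show ?thesis by (simp add: dist_norm)
    qed
    have "eventually P (finite_subsets_at_top E)"
      unfolding eventually_finite_subsets_at_top P_def using F0 by blast
    moreover have "dist (proj F x) (proj F' x) < \<epsilon>" if "P F" "P F'" for F F'
      using half[OF that(1)] half[OF that(2)] dist_triangle_half_l by blast
    ultimately show "\<exists>P. eventually P (finite_subsets_at_top E) \<and>
        (\<forall>F F'. P F \<and> P F' \<longrightarrow> dist (proj F x) (proj F' x) < \<epsilon>)"
      by blast
  qed
  moreover have "complete (UNIV :: 'a set)"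
    by (meson Cauchy_convergent UNIV_I complete_def convergent_def)
  ultimately obtain y where y: "((\<lambda>F. proj F x) \<longlongrightarrow> y) (finite_subsets_at_top E)"
    using complete_uniform[where S="UNIV :: 'a set"] by (force simp add: filterlim_def)
  have "ip e (x - y) = 0" if e: "e \<in> E" for e
  proof -
    have "((\<lambda>F. ip e (proj F x)) \<longlongrightarrow> ip e y) (finite_subsets_at_top E)"
      by (intro ip.tendsto tendsto_const y)
    moreover have "\<forall>\<^sub>F F in finite_subsets_at_top E. ip e (proj F x) = ip e x"
    proof -
      have "\<forall>\<^sub>F F in finite_subsets_at_top E. finite F \<and> {e} \<subseteq> F \<and> F \<subseteq> E"
        unfolding eventually_finite_subsets_at_top using e by (intro exI[of _ "{e}"]) auto
      then show ?thesis
        by (rule eventually_mono) (use on ip_proj_right in auto)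
    qed
    ultimately have "((\<lambda>F. ip e x) \<longlongrightarrow> ip e y) (finite_subsets_at_top E)"
      using tendsto_cong by force
    then have "ip e x = ip e y" by (simp add: tendsto_const_iff)
    then show ?thesis by (simp add: ip.diff_right)
  qed
  then have "x - y = 0" using E unfolding orthonormal_basis_def by blast
  with y show ?thesis by simp
qed

section \<open>Nuclear operators and traces\<close>

definition nuclear_rep :: "(nat \<Rightarrow> 'a) \<Rightarrow> (nat \<Rightarrow> 'a) \<Rightarrow> 'a operator \<Rightarrow> bool"
  where "nuclear_rep a b T \<longleftrightarrow> summable (\<lambda>n. norm (a n) * norm (b n)) \<and>
    (\<forall>x. (\<lambda>n. scl (ip (a n) x) (b n)) sums T x)"

lemma nuclear_op_iff: "nuclear_op scl ip T \<longleftrightarrow> (\<exists>a b. nuclear_rep a b T)"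
  by (simp add: nuclear_op_def nuclear_rep_def)

lemma nuclear_rep_comp_left:
  assumes T: "nuclear_rep a b T" and S: "linear_over K scl S"
  shows "nuclear_rep a (\<lambda>n. S (b n)) (S o\<^sub>L T)"
  unfolding nuclear_rep_def
proof (intro conjI allI)
  show "summable (\<lambda>n. norm (a n) * norm (S (b n)))"
  proof (rule summable_comparison_test')
    show "summable (\<lambda>n. norm S * (norm (a n) * norm (b n)))"
      using T by (simp add: nuclear_rep_def summable_mult)
    show "norm (norm (a n) * norm (S (b n))) \<le> norm S * (norm (a n) * norm (b n))" for n
      using mult_left_mono[OF norm_blinfun[of S "b n"], of "norm (a n)"] by (simp add: mult_ac)
  qed
  fix x
  have "(\<lambda>n. S (scl (ip (a n) x) (b n))) sums S (T x)"
    using T by (intro bounded_linear.sums[OF blinfun.bounded_linear_right]) (simp add: nuclear_rep_def)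
  then show "(\<lambda>n. scl (ip (a n) x) (S (b n))) sums (S o\<^sub>L T) x"
    using S by (simp add: linear_over_def ip_in_scalars)
qed

text \<open>
  Dominated convergence, with the majorant \<open>\<parallel>u\<^sub>n\<parallel> \<parallel>v\<^sub>n\<parallel>\<close> that a nuclear representation provides. It drives
  the approximation both in norm and in trace.
\<close>

lemma proj_defect_tendsto_0:
  fixes u v :: "nat \<Rightarrow> 'a"
  assumes E: "orthonormal_basis ip E" and uv: "summable (\<lambda>n. norm (u n) * norm (v n))"
  shows "((\<lambda>F. \<Sum>n. norm (u n) * norm (proj F (v n) - v n)) \<longlongrightarrow> 0) (finite_subsets_at_top E)"
proof -
  have "((\<lambda>F. \<Sum>n. norm (u n) * norm (proj F (v n) - v n)) \<longlongrightarrow> (\<Sum>n. norm (u n) * norm (v n - v n)))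
      (finite_subsets_at_top E)"
  proof (rule tannerys_theorem[THEN conjunct2, THEN conjunct2, OF _ _ uv])
    show "((\<lambda>F. norm (u n) * norm (proj F (v n) - v n)) \<longlongrightarrow> norm (u n) * norm (v n - v n))
        (finite_subsets_at_top E)" for n
      by (intro tendsto_intros proj_tendsto E)
    have "\<forall>\<^sub>F F in finite_subsets_at_top E. finite F \<and> orthonormal F"
      using orthonormal_subset[OF orthonormal_basisD[OF E]]
      by (intro eventually_finite_subsets_at_top_weakI) auto
    from eventually_prodI[OF always_eventually[OF allI, of "\<lambda>_. True" sequentially, OF TrueI] this]
    show "\<forall>\<^sub>F (n, F) in sequentially \<times>\<^sub>F finite_subsets_at_top E.
        norm (norm (u n) * norm (proj F (v n) - v n)) \<le> norm (u n) * norm (v n)"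
      by eventually_elim (auto intro!: mult_left_mono norm_proj_diff_le)
  qed simp
  then show ?thesis by simp
qed

lemma summable_proj_defect:
  assumes "finite F" "orthonormal F" "summable (\<lambda>n. norm (u n) * norm (v n))"
  shows "summable (\<lambda>n. norm (u n) * norm (proj F (v n) - v n))"
  using assms(3)
  by (rule summable_comparison_test') (auto intro!: mult_left_mono norm_proj_diff_le assms)

text \<open>
  The trace of \<open>X T\<close> for \<open>T = \<Sum> \<langle>a\<^sub>n, \<cdot>\<rangle> b\<^sub>n\<close>, computed from the representation of \<open>T\<close> instead of a basis. In this
  form it is visibly a bounded functional of \<open>X\<close>.
\<close>

definition nuclear_trace :: "(nat \<Rightarrow> 'a) \<Rightarrow> (nat \<Rightarrow> 'a) \<Rightarrow> 'a operator \<Rightarrow> complex"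
  where "nuclear_trace a b X = (\<Sum>n. ip (a n) (X (b n)))"

lemma bounded_linear_nuclear_trace:
  fixes X :: "'a operator"
  assumes ab: "summable (\<lambda>n. norm (a n) * norm (b n))"
  shows "summable (\<lambda>n. ip (a n) (X (b n)))"
    and "norm (nuclear_trace a b X) \<le> norm X * (\<Sum>n. norm (a n) * norm (b n))"
    and "bounded_linear (nuclear_trace a b)"
proof -
  have le: "norm (ip (a n) (X (b n))) \<le> norm X * (norm (a n) * norm (b n))" for n and X :: "'a operator"
    using order_trans[OF norm_ip_le[of "a n" "X (b n)"] mult_left_mono[OF norm_blinfun[of X "b n"] norm_ge_zero[of "a n"]]]
    by (simp add: mult_ac)
  have sm: "summable (\<lambda>n. norm X * (norm (a n) * norm (b n)))" for X :: "'a operator"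
    using ab by (rule summable_mult)
  have summ: "summable (\<lambda>n. ip (a n) (X (b n)))" for X :: "'a operator"
    using le by (intro summable_comparison_test'[OF sm])
  have bnd: "norm (nuclear_trace a b X) \<le> norm X * (\<Sum>n. norm (a n) * norm (b n))" for X :: "'a operator"
    unfolding nuclear_trace_def suminf_mult[OF ab, symmetric]
    by (rule norm_suminf_le[OF le sm])
  show "summable (\<lambda>n. ip (a n) (X (b n)))"
    and "norm (nuclear_trace a b X) \<le> norm X * (\<Sum>n. norm (a n) * norm (b n))"
    by (fact summ bnd)+
  show "bounded_linear (nuclear_trace a b)"
  proof (rule bounded_linear_intro[OF _ _ bnd])
    show "nuclear_trace a b (X + Y) = nuclear_trace a b X + nuclear_trace a b Y" for X Y
      unfolding nuclear_trace_def
      by (simp add: blinfun.add_left ip_add_right suminf_add[OF summ summ])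
    show "nuclear_trace a b (r *\<^sub>R X) = r *\<^sub>R nuclear_trace a b X" for r X
      unfolding nuclear_trace_def
      by (simp add: blinfun.scaleR_left ip_scaleR_right suminf_scaleR_right[OF summ])
  qed
qed

context
  fixes a b T
  assumes T: "nuclear_rep a b T"
begin

lemma nuclear_rep_summable: "summable (\<lambda>n. norm (a n) * norm (b n))"
  and nuclear_rep_sums: "(\<lambda>n. scl (ip (a n) x) (b n)) sums T x"
  using T by (auto simp: nuclear_rep_def)

text \<open>
  Truncating the trace to \<open>F\<close> amounts to projecting the vectors \<open>b\<^sub>n\<close>, so partial traces are compared
  with the full trace through the defects \<open>\<parallel>P\<^sub>F b\<^sub>n - b\<^sub>n\<parallel>\<close>.
\<close>

lemma partial_trace_sums:
  assumes X: "linear_over K scl X"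
  shows "(\<lambda>n. ip (a n) (X (proj F (b n)))) sums (\<Sum>e\<in>F. ip e (T (X e)))"
proof -
  have "(\<lambda>n. \<Sum>e\<in>F. ip e (scl (ip (a n) (X e)) (b n))) sums (\<Sum>e\<in>F. ip e (T (X e)))"
    by (intro sums_sum bounded_linear.sums[OF ip.bounded_linear_right] nuclear_rep_sums)
  moreover have "(\<Sum>e\<in>F. ip e (scl (ip (a n) (X e)) (b n))) = ip (a n) (X (proj F (b n)))" for n
    by (simp add: linear_over_proj_apply[OF X] ip.sum_right ip_scl_right ip_in_scalars mult.commute)
  ultimately show ?thesis by simp
qed

text \<open>
  Both errors, from truncating the basis and from replacing \<open>X\<close> by \<open>Y\<close>, are separated, so that the estimate is
  uniform over bounded sets of operators.
\<close>

lemma partial_trace_approx: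
  assumes X: "linear_over K scl X" and F: "finite F" "orthonormal F"
  shows "norm ((\<Sum>e\<in>F. ip e (T (X e))) - nuclear_trace a b Y)
    \<le> norm X * (\<Sum>n. norm (a n) * norm (proj F (b n) - b n))
      + norm (X - Y) * (\<Sum>n. norm (a n) * norm (b n))"
proof -
  note ab = nuclear_rep_summable
  have dP: "(\<lambda>n. ip (a n) (X (proj F (b n) - b n))) sums ((\<Sum>e\<in>F. ip e (T (X e))) - nuclear_trace a b X)"
    unfolding nuclear_trace_def blinfun.diff_right ip.diff_right
    by (intro sums_diff partial_trace_sums X summable_sums bounded_linear_nuclear_trace(1) ab)
  have le: "norm (ip (a n) (X (proj F (b n) - b n))) \<le> norm X * (norm (a n) * norm (proj F (b n) - b n))" for n
    using order_trans[OF norm_ip_le mult_left_mono[OF norm_blinfun[of X "proj F (b n) - b n"] norm_ge_zero[of "a n"]]]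
    by (simp add: mult_ac)
  have "norm ((\<Sum>e\<in>F. ip e (T (X e))) - nuclear_trace a b X)
      \<le> (\<Sum>n. norm X * (norm (a n) * norm (proj F (b n) - b n)))"
    unfolding sums_unique[OF dP]
    by (rule norm_suminf_le[OF le summable_mult[OF summable_proj_defect[OF F ab]]])
  also have "\<dots> = norm X * (\<Sum>n. norm (a n) * norm (proj F (b n) - b n))"
    by (rule suminf_mult[OF summable_proj_defect[OF F ab]])
  finally have "norm ((\<Sum>e\<in>F. ip e (T (X e))) - nuclear_trace a b X) \<le> \<dots>" .
  moreover have "norm (nuclear_trace a b X - nuclear_trace a b Y) \<le> norm (X - Y) * (\<Sum>n. norm (a n) * norm (b n))"
    using bounded_linear_nuclear_trace(2)[OF ab, of "X - Y"]
    by (simp add: linear_diff[OF bounded_linear.linear[OF bounded_linear_nuclear_trace(3)[OF ab]]])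
  ultimately show ?thesis
    using norm_triangle_ineq[of "(\<Sum>e\<in>F. ip e (T (X e))) - nuclear_trace a b X"
        "nuclear_trace a b X - nuclear_trace a b Y"] by simp
qed

lemma has_sum_nuclear_trace:
  assumes E: "orthonormal_basis ip E"
  shows "((\<lambda>e. ip e (T e)) has_sum nuclear_trace a b id_blinfun) E"
proof -
  let ?\<tau> = "nuclear_trace a b id_blinfun"
  show ?thesis
    unfolding has_sum_def
  proof (rule LIM_zero_cancel, rule Lim_null_comparison)
    show "((\<lambda>F. 1 * (\<Sum>n. norm (a n) * norm (proj F (b n) - b n))) \<longlongrightarrow> 0) (finite_subsets_at_top E)"
      using proj_defect_tendsto_0[OF E nuclear_rep_summable] by simp
    show "\<forall>\<^sub>F F in finite_subsets_at_top E. norm ((\<Sum>e\<in>F. ip e (T e)) - ?\<tau>)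
        \<le> 1 * (\<Sum>n. norm (a n) * norm (proj F (b n) - b n))"
    proof (rule eventually_finite_subsets_at_top_weakI)
      fix F assume "finite F" "F \<subseteq> E"
      then have F: "finite F" "orthonormal F"
        using orthonormal_subset[OF orthonormal_basisD[OF E]] by auto
      have "0 \<le> (\<Sum>n. norm (a n) * norm (proj F (b n) - b n))"
        by (intro suminf_nonneg summable_proj_defect F nuclear_rep_summable) simp
      from mult_right_mono[OF norm_blinfun_id_le[where 'a='a] this]
      show "norm ((\<Sum>e\<in>F. ip e (T e)) - ?\<tau>) \<le> 1 * (\<Sum>n. norm (a n) * norm (proj F (b n) - b n))"
        using partial_trace_approx[OF linear_over_id F, of id_blinfun] by simp
    qed
  qed
qed

lemma trace_op_eq: "trace_op ip T = nuclear_trace a b id_blinfun"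
  unfolding trace_op_def
proof (rule the_equality)
  show "\<forall>E. orthonormal_basis ip E \<longrightarrow> ((\<lambda>e. ip e (T e)) has_sum nuclear_trace a b id_blinfun) E"
    using has_sum_nuclear_trace by blast
  fix \<tau> assume "\<forall>E. orthonormal_basis ip E \<longrightarrow> ((\<lambda>e. ip e (T e)) has_sum \<tau>) E"
  then show "\<tau> = nuclear_trace a b id_blinfun"
    using orthonormal_basis_exists has_sum_nuclear_trace has_sum_unique by blast
qed

lemma norm_proj_comp_diff_le:
  assumes F: "finite F" "orthonormal F"
  shows "norm ((proj F o\<^sub>L T) - T) \<le> (\<Sum>n. norm (a n) * norm (proj F (b n) - b n))"
proof (rule norm_blinfun_bound)
  note sm = summable_proj_defect[OF F nuclear_rep_summable]
  show "0 \<le> (\<Sum>n. norm (a n) * norm (proj F (b n) - b n))" by (intro suminf_nonneg sm) simp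
  fix x
  have "(\<lambda>n. scl (ip (a n) x) (proj F (b n) - b n)) sums (((proj F o\<^sub>L T) - T) x)"
  proof -
    have "(\<lambda>n. proj F (scl (ip (a n) x) (b n)) - scl (ip (a n) x) (b n)) sums (proj F (T x) - T x)"
      by (intro sums_diff bounded_linear.sums[OF blinfun.bounded_linear_right] nuclear_rep_sums)
    moreover have "proj F (scl (ip (a n) x) (b n)) - scl (ip (a n) x) (b n)
        = scl (ip (a n) x) (proj F (b n) - b n)" for n
      using linear_over_proj
      by (simp add: linear_over_def ip_in_scalars linear_diff[OF bounded_linear.linear[OF bounded_linear_scl]])
    ultimately show ?thesis by (simp add: blinfun.diff_left)
  qed
  then have "norm (((proj F o\<^sub>L T) - T) x) = norm (\<Sum>n. scl (ip (a n) x) (proj F (b n) - b n))"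
    by (simp add: sums_iff)
  also have "\<dots> \<le> (\<Sum>n. (norm (a n) * norm (proj F (b n) - b n)) * norm x)"
  proof (rule norm_suminf_le[OF _ summable_mult2[OF sm]])
    fix n
    show "norm (scl (ip (a n) x) (proj F (b n) - b n)) \<le> (norm (a n) * norm (proj F (b n) - b n)) * norm x"
      using mult_right_mono[OF norm_ip_le[of "a n" x], of "norm (proj F (b n) - b n)"]
      by (simp add: norm_scl ip_in_scalars mult_ac)
  qed
  also have "\<dots> = (\<Sum>n. norm (a n) * norm (proj F (b n) - b n)) * norm x"
    by (rule suminf_mult2[OF sm, symmetric])
  finally show "norm (((proj F o\<^sub>L T) - T) x) \<le> (\<Sum>n. norm (a n) * norm (proj F (b n) - b n)) * norm x" .
qed

lemma norm_comp_proj_diff_le: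
  assumes F: "finite F" "orthonormal F"
  shows "norm ((T o\<^sub>L proj F) - T) \<le> (\<Sum>n. norm (b n) * norm (proj F (a n) - a n))"
proof (rule norm_blinfun_bound)
  have "summable (\<lambda>n. norm (b n) * norm (a n))"
    using nuclear_rep_summable by (simp add: mult.commute)
  note sm = summable_proj_defect[OF F this]
  show "0 \<le> (\<Sum>n. norm (b n) * norm (proj F (a n) - a n))" by (intro suminf_nonneg sm) simp
  fix x
  have "(\<lambda>n. scl (ip (proj F (a n) - a n) x) (b n)) sums (((T o\<^sub>L proj F) - T) x)"
  proof -
    have "(\<lambda>n. scl (ip (a n) (proj F x - x)) (b n)) sums T (proj F x - x)"
      by (rule nuclear_rep_sums)
    moreover have "ip (a n) (proj F x - x) = ip (proj F (a n) - a n) x" for n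
      using adjoint_pair_proj by (simp add: adjoint_pair_def ip.diff_left ip.diff_right)
    ultimately show ?thesis by (simp add: blinfun.diff_left blinfun.diff_right)
  qed
  then have "norm (((T o\<^sub>L proj F) - T) x) = norm (\<Sum>n. scl (ip (proj F (a n) - a n) x) (b n))"
    by (simp add: sums_iff)
  also have "\<dots> \<le> (\<Sum>n. (norm (b n) * norm (proj F (a n) - a n)) * norm x)"
  proof (rule norm_suminf_le[OF _ summable_mult2[OF sm]])
    fix n
    show "norm (scl (ip (proj F (a n) - a n) x) (b n)) \<le> (norm (b n) * norm (proj F (a n) - a n)) * norm x"
      using mult_right_mono[OF norm_ip_le[of "proj F (a n) - a n" x], of "norm (b n)"]
      by (simp add: norm_scl ip_in_scalars mult_ac)
  qed
  also have "\<dots> = (\<Sum>n. norm (b n) * norm (proj F (a n) - a n)) * norm x"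
    by (rule suminf_mult2[OF sm, symmetric])
  finally show "norm (((T o\<^sub>L proj F) - T) x) \<le> (\<Sum>n. norm (b n) * norm (proj F (a n) - a n)) * norm x" .
qed

end

section \<open>The determinant of the hyperbolic cosine\<close>

context
  fixes A :: "'a operator" and a b :: "nat \<Rightarrow> 'a" and T :: real
    and W :: "real \<Rightarrow> 'a operator" and \<gamma> :: "real \<Rightarrow> complex" and \<kappa> \<eta> :: real
  assumes A: "linear_over K scl A" "nuclear_rep a b A"
    and W: "\<And>t. t \<in> {0..T} \<Longrightarrow> inverse_pair (hyp 0 t A) (W t)"
      "\<And>t. t \<in> {0..T} \<Longrightarrow> norm (W t) \<le> \<kappa>"
    and H: "\<And>t. t \<in> {0..T} \<Longrightarrow> norm (hyp 1 t A) \<le> \<eta>"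
      "\<And>t. t \<in> {0..T} \<Longrightarrow> norm (hyp 2 t A) \<le> \<eta>"
    and \<gamma>: "\<And>t. t \<in> {0..T} \<Longrightarrow>
      (\<gamma> has_vector_derivative nuclear_trace a b (hyp 1 t A o\<^sub>L W t)) (at t within {0..T})"
      "\<gamma> 0 = 0"
    and \<kappa>: "0 \<le> \<kappa>" and \<eta>: "0 \<le> \<eta>"
begin

text \<open>
  Here \<open>A\<close> stands for the nuclear operator \<open>CB\<close>, \<open>W\<close> is the inverse of \<open>cosh(t \<surd>A)\<close>, and \<open>\<gamma>\<close> a primitive of
  what should be the logarithmic derivative of the determinant, \<open>tr(A (sinh(t \<surd>A)/\<surd>A) W)\<close>. The defects
  bound the errors made by compressing to the span of \<open>F\<close>: in traces, in norm, and in the logarithmic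
  derivative. They are the same for all times in \<open>[0, T]\<close>.
\<close>

definition trace_defect :: "'a set \<Rightarrow> real"
  where "trace_defect F = (\<Sum>n. norm (a n) * norm (proj F (b n) - b n))"

definition norm_defect :: "'a set \<Rightarrow> real"
  where "norm_defect F = trace_defect F + (\<Sum>n. norm (b n) * norm (proj F (a n) - a n))"

definition log_derivative_defect :: "'a set \<Rightarrow> real"
  where "log_derivative_defect F = \<eta> * (2 * \<kappa>) * trace_defect F
    + \<eta> * (2 * \<kappa>\<^sup>2 * (\<eta> * norm_defect F)) * (\<Sum>n. norm (a n) * norm (b n))"

lemma norm_compression_diff_le:
  assumes F: "finite F" "orthonormal F" and t: "t \<in> {0..T}"
  shows "norm ((id_blinfun + (proj F o\<^sub>L (A o\<^sub>L hyp 2 t A) o\<^sub>L proj F)) - hyp 0 t A) \<le> \<eta> * norm_defect F"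
proof -
  let ?P = "proj F" and ?G = "hyp 2 t A"
  have 1: "norm ((?P o\<^sub>L A) - A) \<le> trace_defect F"
    unfolding trace_defect_def by (rule norm_proj_comp_diff_le[OF A(2) F])
  have 2: "norm ((A o\<^sub>L ?P) - A) \<le> (\<Sum>n. norm (b n) * norm (proj F (a n) - a n))"
    by (rule norm_comp_proj_diff_le[OF A(2) F])
  have M: "hyp 0 t A = id_blinfun + (A o\<^sub>L ?G)" by (rule hyp_0_eq)
  \<comment> \<open>\<open>A G = G A\<close> exposes \<open>P A - A\<close> on the left and \<open>A P - A\<close> on the right.\<close>
  have "(id_blinfun + (?P o\<^sub>L (A o\<^sub>L ?G) o\<^sub>L ?P)) - hyp 0 t A
      = ((((?P o\<^sub>L A) - A) o\<^sub>L ?G) o\<^sub>L ?P) + (?G o\<^sub>L ((A o\<^sub>L ?P) - A))"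
  proof (rule blinfun_eqI)
    have "A (?G x) = ?G (A x)" for x
      using arg_cong[OF hyp_commute[of A 2 t], of "\<lambda>T. T x"] by simp
    then show "((id_blinfun + (?P o\<^sub>L (A o\<^sub>L ?G) o\<^sub>L ?P)) - hyp 0 t A) x
        = (((((?P o\<^sub>L A) - A) o\<^sub>L ?G) o\<^sub>L ?P) + (?G o\<^sub>L ((A o\<^sub>L ?P) - A))) x" for x
      by (simp add: M blinfun.add_left blinfun.diff_left blinfun.diff_right)
  qed
  also have "norm \<dots> \<le> norm ((((?P o\<^sub>L A) - A) o\<^sub>L ?G) o\<^sub>L ?P) + norm (?G o\<^sub>L ((A o\<^sub>L ?P) - A))"
    by (rule norm_triangle_ineq)
  also have "\<dots> \<le> norm ((?P o\<^sub>L A) - A) * \<eta> * 1 + \<eta> * norm ((A o\<^sub>L ?P) - A)"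
  proof (rule add_mono)
    show "norm ((((?P o\<^sub>L A) - A) o\<^sub>L ?G) o\<^sub>L ?P) \<le> norm ((?P o\<^sub>L A) - A) * \<eta> * 1"
      using H(2)[OF t] norm_proj_le[OF F] \<eta>
      by (intro order_trans[OF norm_blinfun_compose] mult_mono order_trans[OF norm_blinfun_compose[of "(?P o\<^sub>L A) - A" ?G]]) auto
    show "norm (?G o\<^sub>L ((A o\<^sub>L ?P) - A)) \<le> \<eta> * norm ((A o\<^sub>L ?P) - A)"
      using H(2)[OF t] by (intro order_trans[OF norm_blinfun_compose] mult_right_mono) auto
  qed
  also have "\<dots> \<le> \<eta> * norm_defect F"
    using mult_left_mono[OF 1 \<eta>] mult_left_mono[OF 2 \<eta>]
    by (simp add: norm_defect_def algebra_simps)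
  finally show ?thesis .
qed

text \<open>
  Write \<open>P\<close> for the projection and \<open>M = cosh(t \<surd>A) = I + A G\<close>. For \<open>F\<close> large, \<open>I + P A G P\<close> is close to
  \<open>M\<close> and has an inverse \<open>Z\<close> close to \<open>W\<close>. As \<open>(I + P A G P) f = P M f\<close> for \<open>f \<in> F\<close>, one has \<open>Z P M f = f\<close>, hence
  \<open>P M' f = (P M' Z) (P M f)\<close>: on the span of \<open>F\<close> the compressed matrix solves a linear equation with
  coefficient \<open>P M' Z = P A (sinh(t \<surd>A)/\<surd>A) Z\<close>, and Jacobi's formula gives the partial trace of \<open>A (sinh(t \<surd>A)/\<surd>A) Z\<close>
  as logarithmic derivative.
\<close>

lemma compressed_det_has_vector_derivative:
  assumes F: "finite F" "orthonormal F" and t: "t \<in> {0..T}"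
    and small: "\<eta> * norm_defect F * \<kappa> \<le> 1/2"
  obtains g where
    "((\<lambda>t. leibniz_det F (\<lambda>e f. ip e (hyp 0 t A f))) has_vector_derivative
      g * leibniz_det F (\<lambda>e f. ip e (hyp 0 t A f))) (at t within {0..T})"
    "norm (g - nuclear_trace a b (hyp 1 t A o\<^sub>L W t)) \<le> log_derivative_defect F"
proof -
  let ?P = "proj F" and ?G = "hyp 2 t A" and ?H = "hyp 1 t A" and ?M = "hyp 0 t A"
  let ?N = "?P o\<^sub>L (A o\<^sub>L ?G) o\<^sub>L ?P"
  note diff = norm_compression_diff_le[OF F t]
  have "norm ((id_blinfun + ?N) - ?M) * \<kappa> \<le> 1/2"
    using mult_right_mono[OF diff \<kappa>] small by simp
  then obtain Z where Z: "inverse_pair (id_blinfun + ?N) Z" "norm Z \<le> 2 * \<kappa>"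
      "norm (Z - W t) \<le> 2 * \<kappa>\<^sup>2 * norm ((id_blinfun + ?N) - ?M)"
    by (rule inverse_pair_perturb[OF W(1)[OF t] W(2)[OF t]])
  have lin: "linear_over K scl ?M" "linear_over K scl ?H" "linear_over K scl ?G"
    by (intro linear_over_hyp A)+
  have "linear_over K scl (id_blinfun + ?N)"
    by (intro linear_over_add linear_over_id linear_over_comp linear_over_proj A lin)
      (auto intro: bounded_linear_scl)
  then have "linear_over K scl Z" by (rule linear_over_inverse_pair) (rule Z)
  then have HZ: "linear_over K scl (?H o\<^sub>L Z)" and AHZ: "linear_over K scl (A o\<^sub>L (?H o\<^sub>L Z))"
    by (intro linear_over_comp lin A; assumption)+
  have Z_proj: "Z (?P (?M f)) = f" if f: "f \<in> F" for f
  proof -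
    have Pf: "?P f = f" by (rule proj_in[OF F f])
    have M: "?M f = f + A (?G f)"
      by (simp add: hyp_0_eq blinfun.add_left)
    have "?P (?M f) = (id_blinfun + ?N) f"
      by (simp add: M blinfun.add_left blinfun.add_right Pf)
    then show ?thesis by (simp only: inverse_pair_apply(2)[OF Z(1)])
  qed
  define g where "g = (\<Sum>e\<in>F. ip e (A ((?H o\<^sub>L Z) e)))"
  have "((\<lambda>t. leibniz_det F (\<lambda>e f. ip e (hyp 0 t A f))) has_vector_derivative
      g * leibniz_det F (\<lambda>e f. ip e (?M f))) (at t within {0..T})"
    unfolding g_def
  proof (rule leibniz_det_has_vector_derivative[OF F(1), where Z="\<lambda>e f. ip e (A ((?H o\<^sub>L Z) f))"])
    fix e f assume ef: "e \<in> F" "f \<in> F"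
    have "((\<lambda>t. hyp 0 t A) has_vector_derivative (A o\<^sub>L ?H)) (at t within {0..T})"
      by (rule has_vector_derivative_at_within[OF hyp_0_has_vector_derivative])
    then have "((\<lambda>t. ip e (hyp 0 t A f)) has_vector_derivative ip e ((A o\<^sub>L ?H) f)) (at t within {0..T})"
      by (intro bounded_linear.has_vector_derivative[OF ip.bounded_linear_right]
          bounded_linear.has_vector_derivative[OF blinfun.bounded_linear_left])
    also have "ip e ((A o\<^sub>L ?H) f) = ip e ((A o\<^sub>L (?H o\<^sub>L Z)) (?P (?M f)))"
      by (simp add: Z_proj[OF ef(2)])
    also have "\<dots> = (\<Sum>g\<in>F. ip e (A ((?H o\<^sub>L Z) g)) * ip g (?M f))"
      unfolding linear_over_proj_apply[OF AHZ]
      by (simp add: ip.sum_right ip_scl_right ip_in_scalars mult.commute)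
    finally show "((\<lambda>t. ip e (hyp 0 t A f)) has_vector_derivative
        (\<Sum>g\<in>F. ip e (A ((?H o\<^sub>L Z) g)) * ip g (?M f))) (at t within {0..T})" .
  qed
  moreover have "norm (g - nuclear_trace a b (?H o\<^sub>L W t)) \<le> log_derivative_defect F"
  proof -
    have "norm (g - nuclear_trace a b (?H o\<^sub>L W t)) \<le> norm (?H o\<^sub>L Z) * trace_defect F
        + norm ((?H o\<^sub>L Z) - (?H o\<^sub>L W t)) * (\<Sum>n. norm (a n) * norm (b n))"
      unfolding g_def trace_defect_def by (rule partial_trace_approx[OF A(2) HZ F])
    also have "\<dots> \<le> log_derivative_defect F"
      unfolding log_derivative_defect_def
    proof (intro add_mono mult_right_mono)
      show "norm (?H o\<^sub>L Z) \<le> \<eta> * (2 * \<kappa>)"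
        using H(1)[OF t] Z(2) \<eta> by (intro order_trans[OF norm_blinfun_compose] mult_mono) auto
      have "norm (Z - W t) \<le> 2 * \<kappa>\<^sup>2 * (\<eta> * norm_defect F)"
        using diff by (intro order_trans[OF Z(3)] mult_left_mono) auto
      then show "norm ((?H o\<^sub>L Z) - (?H o\<^sub>L W t)) \<le> \<eta> * (2 * \<kappa>\<^sup>2 * (\<eta> * norm_defect F))"
        unfolding op_comp.diff_right[symmetric]
        using H(1)[OF t] \<eta> by (intro order_trans[OF norm_blinfun_compose] mult_mono) auto
      show "0 \<le> trace_defect F"
        unfolding trace_defect_def
        by (intro suminf_nonneg summable_proj_defect[OF F nuclear_rep_summable[OF A(2)]]) simp
      show "0 \<le> (\<Sum>n. norm (a n) * norm (b n))"
        by (intro suminf_nonneg nuclear_rep_summable[OF A(2)]) simp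
    qed
    finally show ?thesis .
  qed
  ultimately show thesis by (rule that)
qed

text \<open>
  The quotient of the compressed determinant by \<open>exp \<gamma>\<close> starts at \<open>1\<close> and has a small logarithmic
  derivative, so it stays near \<open>1\<close>.
\<close>

lemma compressed_det_approx:
  assumes F: "finite F" "orthonormal F" and t: "t \<in> {0..T}"
    and small: "\<eta> * norm_defect F * \<kappa> \<le> 1/2" "log_derivative_defect F * T \<le> 1/2"
  shows "norm (leibniz_det F (\<lambda>e f. ip e (hyp 0 t A f)) - exp (\<gamma> t))
    \<le> 2 * log_derivative_defect F * T * norm (exp (\<gamma> t))"
proof -
  let ?D = "\<lambda>t. leibniz_det F (\<lambda>e f. ip e (hyp 0 t A f))"
  let ?q = "\<lambda>t. ?D t * exp (- \<gamma> t)"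
  let ?tr = "\<lambda>t. nuclear_trace a b (hyp 1 t A o\<^sub>L W t)"
  have "\<exists>q'. (?q has_vector_derivative q') (at u within {0..T}) \<and>
      norm q' \<le> log_derivative_defect F * norm (?q u)" if u: "u \<in> {0..T}" for u
  proof -
    obtain g where g: "(?D has_vector_derivative g * ?D u) (at u within {0..T})"
        "norm (g - ?tr u) \<le> log_derivative_defect F"
      using compressed_det_has_vector_derivative[OF F u small(1)] .
    have "((\<lambda>u. - \<gamma> u) has_vector_derivative - ?tr u) (at u within {0..T})"
      by (rule has_vector_derivative_minus[OF \<gamma>(1)[OF u]])
    then have "((exp \<circ> (\<lambda>u. - \<gamma> u)) has_vector_derivative - ?tr u * exp (- \<gamma> u)) (at u within {0..T})"
      by (rule field_vector_diff_chain_within[OF _ has_field_derivative_at_within[OF DERIV_exp]])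
    then have "((\<lambda>u. exp (- \<gamma> u)) has_vector_derivative - ?tr u * exp (- \<gamma> u)) (at u within {0..T})"
      by (simp add: o_def)
    from has_vector_derivative_mult[OF g(1) this]
    have "(?q has_vector_derivative (g - ?tr u) * ?q u) (at u within {0..T})"
      by (simp add: algebra_simps)
    moreover have "norm ((g - ?tr u) * ?q u) \<le> log_derivative_defect F * norm (?q u)"
      unfolding norm_mult[of "g - ?tr u"] by (rule mult_right_mono[OF g(2)]) simp
    ultimately show ?thesis by blast
  qed
  then have "\<forall>u\<in>{0..T}. \<exists>q'. (?q has_vector_derivative q') (at u within {0..T}) \<and>
      norm q' \<le> log_derivative_defect F * norm (?q u)"
    by (rule ballI)
  from bchoice[OF this] obtain q' where "\<forall>u\<in>{0..T}. (?q has_vector_derivative q' u) (at u within {0..T}) \<and>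
      norm (q' u) \<le> log_derivative_defect F * norm (?q u)" ..
  then have q': "\<And>u. u \<in> {0..T} \<Longrightarrow> (?q has_vector_derivative q' u) (at u within {0..T})"
      "\<And>u. u \<in> {0..T} \<Longrightarrow> norm (q' u) \<le> log_derivative_defect F * norm (?q u)"
    by simp_all
  have q0: "?q 0 = 1"
    using F \<gamma>(2) by (simp add: hyp_at_0 leibniz_det_identity orthonormal_def)
  have "0 \<le> log_derivative_defect F"
    by (rule compressed_det_has_vector_derivative[OF F t small(1)]) (rule order_trans[OF norm_ge_zero])
  from linear_growth_near_constant[OF q' this small(2) t]
  have "norm (?q t - 1) \<le> 2 * log_derivative_defect F * T"
    by (simp add: q0)
  moreover have "?D t - exp (\<gamma> t) = (?q t - 1) * exp (\<gamma> t)"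
    by (simp add: algebra_simps exp_minus)
  ultimately show ?thesis
    by (simp only: norm_mult) (rule mult_right_mono, simp_all)
qed

lemma det_op_hyp_0:
  assumes t: "t \<in> {0..T}"
  shows "det_op ip (hyp 0 t A) = exp (\<gamma> t)"
proof -
  have lim: "((\<lambda>F. \<Sum>p | p permutes F. of_int (sign p) * (\<Prod>e\<in>F. ip e (hyp 0 t A (p e)))) \<longlongrightarrow> exp (\<gamma> t))
      (finite_subsets_at_top E)" (is "(?D \<longlongrightarrow> _) _") if E: "orthonormal_basis ip E" for E
  proof -
    have ba: "summable (\<lambda>n. norm (b n) * norm (a n))"
      using nuclear_rep_summable[OF A(2)] by (simp add: mult.commute)
    have td: "(trace_defect \<longlongrightarrow> 0) (finite_subsets_at_top E)"
      unfolding trace_defect_def[abs_def]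
      by (rule proj_defect_tendsto_0[OF E nuclear_rep_summable[OF A(2)]])
    have nd: "(norm_defect \<longlongrightarrow> 0) (finite_subsets_at_top E)"
      using tendsto_add[OF td proj_defect_tendsto_0[OF E ba]] by (simp add: norm_defect_def[abs_def])
    have ld: "(log_derivative_defect \<longlongrightarrow> 0) (finite_subsets_at_top E)"
    proof -
      have "(log_derivative_defect \<longlongrightarrow> \<eta> * (2 * \<kappa>) * 0
          + \<eta> * (2 * \<kappa>\<^sup>2 * (\<eta> * 0)) * (\<Sum>n. norm (a n) * norm (b n))) (finite_subsets_at_top E)"
        unfolding log_derivative_defect_def[abs_def] by (intro tendsto_intros td nd)
      then show ?thesis by simp
    qed
    have small: "((\<lambda>F. \<eta> * norm_defect F * \<kappa>) \<longlongrightarrow> \<eta> * 0 * \<kappa>) (finite_subsets_at_top E)"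
      "((\<lambda>F. log_derivative_defect F * T) \<longlongrightarrow> 0 * T) (finite_subsets_at_top E)"
      by (intro tendsto_intros nd ld)+
    have ev: "\<forall>\<^sub>F F in finite_subsets_at_top E. \<eta> * norm_defect F * \<kappa> < 1/2"
      "\<forall>\<^sub>F F in finite_subsets_at_top E. log_derivative_defect F * T < 1/2"
      by (rule order_tendstoD(2)[OF small(1)], simp, rule order_tendstoD(2)[OF small(2)], simp)
    have "\<forall>\<^sub>F F in finite_subsets_at_top E. finite F \<and> orthonormal F"
      using orthonormal_subset[OF orthonormal_basisD[OF E]]
      by (intro eventually_finite_subsets_at_top_weakI) auto
    with ev have "\<forall>\<^sub>F F in finite_subsets_at_top E.
        norm (?D F - exp (\<gamma> t)) \<le> 2 * log_derivative_defect F * T * norm (exp (\<gamma> t))"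
      by eventually_elim
        (use compressed_det_approx[OF _ _ t] in \<open>auto simp: leibniz_det_def less_imp_le\<close>)
    moreover have "((\<lambda>F. 2 * log_derivative_defect F * T * norm (exp (\<gamma> t))) \<longlongrightarrow> 0) (finite_subsets_at_top E)"
      using tendsto_mult_right[OF tendsto_mult_right[OF tendsto_mult_left[OF ld, of 2], of T], of "norm (exp (\<gamma> t))"]
      by (simp only: mult_zero_left mult_zero_right)
    ultimately have "((\<lambda>F. ?D F - exp (\<gamma> t)) \<longlongrightarrow> 0) (finite_subsets_at_top E)"
      by (rule Lim_null_comparison)
    then show ?thesis by (rule LIM_zero_cancel)
  qed
  show ?thesis
    unfolding det_op_def
  proof (rule the_equality)
    show "\<forall>E. orthonormal_basis ip E \<longrightarrow>
        ((\<lambda>F. \<Sum>p | p permutes F. of_int (sign p) * (\<Prod>e\<in>F. ip e (hyp 0 t A (p e)))) \<longlongrightarrow> exp (\<gamma> t))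
          (finite_subsets_at_top E)"
      using lim by blast
    fix \<delta> assume \<delta>: "\<forall>E. orthonormal_basis ip E \<longrightarrow>
        ((\<lambda>F. \<Sum>p | p permutes F. of_int (sign p) * (\<Prod>e\<in>F. ip e (hyp 0 t A (p e)))) \<longlongrightarrow> \<delta>)
          (finite_subsets_at_top E)"
    obtain E where E: "orthonormal_basis ip E" using orthonormal_basis_exists ..
    show "\<delta> = exp (\<gamma> t)"
      by (rule tendsto_unique[OF finite_subsets_at_top_neq_bot \<delta>[rule_format, OF E] lim[OF E]])
  qed
qed

end

section \<open>The hyperbolic solution of the Riccati system\<close>

lemma nuclear_rep_comp_symmetric:
  assumes T: "nuclear_rep a b T" and C: "symmetric_op ip C"
  shows "nuclear_rep (\<lambda>n. C (a n)) b (T o\<^sub>L C)"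
  unfolding nuclear_rep_def
proof (intro conjI allI)
  show "summable (\<lambda>n. norm (C (a n)) * norm (b n))"
  proof (rule summable_comparison_test')
    show "summable (\<lambda>n. norm C * (norm (a n) * norm (b n)))"
      using T by (simp add: nuclear_rep_def summable_mult)
    show "norm (norm (C (a n)) * norm (b n)) \<le> norm C * (norm (a n) * norm (b n))" for n
      using mult_right_mono[OF norm_blinfun[of C "a n"], of "norm (b n)"] by (simp add: mult_ac)
  qed
  show "(\<lambda>n. scl (ip (C (a n)) x) (b n)) sums (T o\<^sub>L C) x" for x
    using T C by (simp add: nuclear_rep_def symmetric_op_def)
qed

lemma trace_op_cnj:
  assumes "nuclear_rep a b S" "nuclear_rep a' b' T" "adjoint_pair ip S T"
  shows "cnj (trace_op ip S) = trace_op ip T"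
proof -
  have has_sum: "((\<lambda>e. ip e (R e)) has_sum trace_op ip R) E"
    if "nuclear_rep u v R" "orthonormal_basis ip E" for u v R E
    using has_sum_nuclear_trace[OF that] by (simp add: trace_op_eq[OF that(1)])
  obtain E where E: "orthonormal_basis ip E" using orthonormal_basis_exists ..
  have "((\<lambda>e. cnj (ip e (S e))) has_sum cnj (trace_op ip S)) E"
    using has_sum[OF assms(1) E] by simp
  moreover have "cnj (ip e (S e)) = ip e (T e)" for e
    using assms(3) ip_cnj[of e "S e"] by (simp add: adjoint_pair_def)
  ultimately show ?thesis
    using has_sum_unique has_sum[OF assms(2) E] by auto
qed

lemma nonneg_op_Re: "nonneg_op ip B \<Longrightarrow> 0 \<le> Re (ip x (B x))"
  by (auto simp: nonneg_op_def complex_nonneg_Reals_iff)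

text \<open>\<open>cosh(t \<surd>(BC)) = I + B Y\<close> with \<open>Y = C (cosh(t \<surd>(BC)) - 1)/(BC)\<close> symmetric and nonnegative.\<close>

lemma cosh_invertible:
  fixes B C :: "'a operator"
  assumes B: "symmetric_op ip B" "nonneg_op ip B"
    and C: "symmetric_op ip C" "nonneg_op ip C"
    and t: "t \<ge> 0"
  obtains S where "inverse_pair (hyp 0 t (B o\<^sub>L C)) S"
proof -
  note nn = nonneg_op_Re[OF B(2)] nonneg_op_Re[OF C(2)]
  have "hyp 0 t (B o\<^sub>L C) = id_blinfun + (B o\<^sub>L (C o\<^sub>L hyp 2 t (B o\<^sub>L C)))"
    by (simp only: hyp_0_eq op_comp_assoc)
  moreover obtain S where "inverse_pair (id_blinfun + (B o\<^sub>L (C o\<^sub>L hyp 2 t (B o\<^sub>L C)))) S"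
    by (rule inverse_pair_id_plus_comp[OF sandwich_hyp[OF B(1) nn(1) C(1) nn(2) t, where j=2] nn(1)])
  ultimately show thesis using that by simp
qed

context
  fixes B C :: "'a operator"
  assumes B: "symmetric_op ip B" "nonneg_op ip B"
    and C: "symmetric_op ip C" "nonneg_op ip C"
begin

abbreviation (input) "cosh_BC t \<equiv> hyp 0 t (B o\<^sub>L C)"
abbreviation (input) "sinhc_BC t \<equiv> hyp 1 t (B o\<^sub>L C)"
abbreviation (input) "sech_BC t \<equiv> inverse_op (hyp 0 t (B o\<^sub>L C))"
abbreviation (input) "sech_CB t \<equiv> inverse_op (hyp 0 t (C o\<^sub>L B))"
abbreviation (input) "tanhc_BC t \<equiv> sinhc_BC t o\<^sub>L sech_BC t"

lemma sech_BC_inverse: "t \<ge> 0 \<Longrightarrow> inverse_pair (cosh_BC t) (sech_BC t)"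
  using cosh_invertible[OF B C] inverse_op_eq by metis

lemma sech_CB_inverse: "t \<ge> 0 \<Longrightarrow> inverse_pair (hyp 0 t (C o\<^sub>L B)) (sech_CB t)"
  using cosh_invertible[OF C B] inverse_op_eq by metis

lemma intertwine:
  shows C_hyp: "C o\<^sub>L hyp j t (B o\<^sub>L C) = hyp j t (C o\<^sub>L B) o\<^sub>L C"
    and C_sech: "t \<ge> 0 \<Longrightarrow> C o\<^sub>L sech_BC t = sech_CB t o\<^sub>L C"
    and hyp_sech: "t \<ge> 0 \<Longrightarrow> hyp j t (B o\<^sub>L C) o\<^sub>L sech_BC t = sech_BC t o\<^sub>L hyp j t (B o\<^sub>L C)"
proof -
  show C_hyp: "C o\<^sub>L hyp j t (B o\<^sub>L C) = hyp j t (C o\<^sub>L B) o\<^sub>L C" for j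
    by (rule hyp_intertwine) (simp add: op_comp_assoc)
  show "C o\<^sub>L sech_BC t = sech_CB t o\<^sub>L C" if "t \<ge> 0"
    by (rule inverse_pair_intertwine[OF sech_BC_inverse[OF that] sech_CB_inverse[OF that] C_hyp])
  show "hyp j t (B o\<^sub>L C) o\<^sub>L sech_BC t = sech_BC t o\<^sub>L hyp j t (B o\<^sub>L C)" if "t \<ge> 0"
    by (rule inverse_pair_intertwine[OF sech_BC_inverse[OF that] sech_BC_inverse[OF that] hyp_commute_hyp])
qed

lemma adjoint_BC: "adjoint_pair ip (B o\<^sub>L C) (C o\<^sub>L B)"
  using B(1) C(1) by (auto simp: symmetric_op_iff_adjoint_pair intro: adjoint_pair_comp)

lemma adjoint_pair_sech: "t \<ge> 0 \<Longrightarrow> adjoint_pair ip (sech_BC t) (sech_CB t)"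
  by (rule adjoint_pair_inverse_pair[OF adjoint_pair_hyp[OF adjoint_BC] sech_BC_inverse sech_CB_inverse])

lemma sech_derivative:
  assumes t: "t \<ge> 0"
  shows "(sech_BC has_vector_derivative - (tanhc_BC t o\<^sub>L (B o\<^sub>L C) o\<^sub>L sech_BC t)) (at t within {0..})"
proof -
  have "(sech_BC has_vector_derivative - (sech_BC t o\<^sub>L ((B o\<^sub>L C) o\<^sub>L sinhc_BC t) o\<^sub>L sech_BC t)) (at t within {0..})"
  proof (rule inverse_pair_has_vector_derivative[where U="\<lambda>t. cosh_BC t"])
    show "((\<lambda>t. cosh_BC t) has_vector_derivative ((B o\<^sub>L C) o\<^sub>L sinhc_BC t)) (at t within {0..})"
      by (rule has_vector_derivative_at_within[OF hyp_0_has_vector_derivative])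
  qed (use t sech_BC_inverse in auto)
  moreover have "sech_BC t o\<^sub>L ((B o\<^sub>L C) o\<^sub>L sinhc_BC t) o\<^sub>L sech_BC t = tanhc_BC t o\<^sub>L (B o\<^sub>L C) o\<^sub>L sech_BC t"
  proof -
    have "sech_BC t o\<^sub>L ((B o\<^sub>L C) o\<^sub>L sinhc_BC t) o\<^sub>L sech_BC t = sech_BC t o\<^sub>L (sinhc_BC t o\<^sub>L (B o\<^sub>L C)) o\<^sub>L sech_BC t"
      by (simp only: hyp_commute)
    also have "\<dots> = (sech_BC t o\<^sub>L sinhc_BC t) o\<^sub>L (B o\<^sub>L C) o\<^sub>L sech_BC t"
      by (simp only: op_comp_assoc)
    finally show ?thesis by (simp only: hyp_sech[OF t])
  qed
  ultimately show ?thesis by simp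
qed

lemma tanhc_derivative:
  assumes t: "t \<ge> 0"
  shows "(tanhc_BC has_vector_derivative id_blinfun - (tanhc_BC t o\<^sub>L (B o\<^sub>L C) o\<^sub>L tanhc_BC t)) (at t within {0..})"
proof -
  have "((\<lambda>t. sinhc_BC t) has_vector_derivative cosh_BC t) (at t within {0..})"
    using has_vector_derivative_at_within[OF hyp_Suc_has_vector_derivative[of 0 "B o\<^sub>L C" t]]
    by (simp only: One_nat_def)
  from op_comp.has_vector_derivative[OF this sech_derivative[OF t]]
  have "(tanhc_BC has_vector_derivative (sinhc_BC t o\<^sub>L - (tanhc_BC t o\<^sub>L (B o\<^sub>L C) o\<^sub>L sech_BC t)) + (cosh_BC t o\<^sub>L sech_BC t)) (at t within {0..})" .
  moreover have "sinhc_BC t o\<^sub>L (tanhc_BC t o\<^sub>L (B o\<^sub>L C) o\<^sub>L sech_BC t) = tanhc_BC t o\<^sub>L (B o\<^sub>L C) o\<^sub>L tanhc_BC t"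
  proof -
    have "sinhc_BC t o\<^sub>L (tanhc_BC t o\<^sub>L (B o\<^sub>L C) o\<^sub>L sech_BC t) = sinhc_BC t o\<^sub>L ((sinhc_BC t o\<^sub>L sech_BC t) o\<^sub>L (B o\<^sub>L C)) o\<^sub>L sech_BC t"
      by (simp only: op_comp_assoc)
    also have "\<dots> = sinhc_BC t o\<^sub>L (sech_BC t o\<^sub>L (sinhc_BC t o\<^sub>L (B o\<^sub>L C))) o\<^sub>L sech_BC t"
      by (simp only: hyp_sech[OF t] op_comp_assoc)
    also have "\<dots> = sinhc_BC t o\<^sub>L (sech_BC t o\<^sub>L ((B o\<^sub>L C) o\<^sub>L sinhc_BC t)) o\<^sub>L sech_BC t"
      by (simp only: hyp_commute)
    finally show ?thesis by (simp only: op_comp_assoc)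
  qed
  ultimately show ?thesis
    using sech_BC_inverse[OF t] by (simp add: inverse_pair_def op_comp.minus_right)
qed

text \<open>\<open>1 - tanh\<^sup>2 = cosh\<^sup>-\<^sup>2\<close>, with the factors put in the order in which they occur in the Riccati equation.\<close>

lemma tanhc_derivative_eq_sech_squared:
  assumes t: "t \<ge> 0"
  shows "id_blinfun - (tanhc_BC t o\<^sub>L (B o\<^sub>L C) o\<^sub>L tanhc_BC t) = sech_BC t o\<^sub>L sech_BC t"
proof -
  let ?A = "B o\<^sub>L C"
  have "sech_BC t o\<^sub>L sech_BC t = sech_BC t o\<^sub>L ((cosh_BC t o\<^sub>L cosh_BC t) - (?A o\<^sub>L (sinhc_BC t o\<^sub>L sinhc_BC t))) o\<^sub>L sech_BC t"
    by (simp only: hyp_cosh_sinh_identity id_op_comp)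
  also have "\<dots> = ((sech_BC t o\<^sub>L cosh_BC t) o\<^sub>L (cosh_BC t o\<^sub>L sech_BC t)) - (sech_BC t o\<^sub>L ?A o\<^sub>L sinhc_BC t o\<^sub>L sinhc_BC t o\<^sub>L sech_BC t)"
    by (simp only: op_comp.diff_left op_comp.diff_right op_comp_assoc)
  also have "(sech_BC t o\<^sub>L cosh_BC t) o\<^sub>L (cosh_BC t o\<^sub>L sech_BC t) = id_blinfun"
    using sech_BC_inverse[OF t] by (simp add: inverse_pair_def)
  also have "sech_BC t o\<^sub>L ?A o\<^sub>L sinhc_BC t o\<^sub>L sinhc_BC t o\<^sub>L sech_BC t = sech_BC t o\<^sub>L (?A o\<^sub>L sinhc_BC t) o\<^sub>L sinhc_BC t o\<^sub>L sech_BC t"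
    by (simp only: op_comp_assoc)
  also have "\<dots> = (sech_BC t o\<^sub>L sinhc_BC t) o\<^sub>L ?A o\<^sub>L sinhc_BC t o\<^sub>L sech_BC t"
    by (simp only: hyp_commute op_comp_assoc)
  also have "\<dots> = tanhc_BC t o\<^sub>L ?A o\<^sub>L tanhc_BC t"
    by (simp only: hyp_sech[OF t, symmetric] op_comp_assoc)
  finally show ?thesis by simp
qed

lemma Q_derivative:
  assumes t: "t \<ge> 0"
  shows "((\<lambda>t. tanhc_BC t o\<^sub>L B) has_vector_derivative B - ((tanhc_BC t o\<^sub>L B) o\<^sub>L C o\<^sub>L (tanhc_BC t o\<^sub>L B))) (at t within {0..})"
  using bounded_linear.has_vector_derivative[OF op_comp.bounded_linear_left tanhc_derivative[OF t], of B]
  by (simp add: op_comp.diff_left op_comp_assoc)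

lemma P_derivative:
  assumes t: "t \<ge> 0"
  shows "((\<lambda>t. C o\<^sub>L tanhc_BC t) has_vector_derivative adjoint_op ip (sech_BC t) o\<^sub>L C o\<^sub>L sech_BC t) (at t within {0..})"
proof -
  have "((\<lambda>t. C o\<^sub>L tanhc_BC t) has_vector_derivative C o\<^sub>L (sech_BC t o\<^sub>L sech_BC t)) (at t within {0..})"
    using bounded_linear.has_vector_derivative[OF op_comp.bounded_linear_right tanhc_derivative[OF t], of C]
    by (simp only: tanhc_derivative_eq_sech_squared[OF t])
  also have "C o\<^sub>L (sech_BC t o\<^sub>L sech_BC t) = (C o\<^sub>L sech_BC t) o\<^sub>L sech_BC t"
    by (simp only: op_comp_assoc)
  finally show ?thesis by (simp only: C_sech[OF t] adjoint_op_eq[OF adjoint_pair_sech[OF t]])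
qed

lemma R_derivative:
  assumes t: "t \<ge> 0"
  shows "(sech_BC has_vector_derivative - ((tanhc_BC t o\<^sub>L B) o\<^sub>L C o\<^sub>L sech_BC t)) (at t within {0..})"
  using sech_derivative[OF t] by (simp only: op_comp_assoc)

lemma symmetric_C_tanhc:
  assumes t: "t \<ge> 0"
  shows "symmetric_op ip (C o\<^sub>L tanhc_BC t)"
proof -
  have "adjoint_pair ip (C o\<^sub>L tanhc_BC t) ((sech_CB t o\<^sub>L hyp 1 t (C o\<^sub>L B)) o\<^sub>L C)"
    using C(1)
    by (intro adjoint_pair_comp adjoint_pair_hyp[OF adjoint_BC] adjoint_pair_sech[OF t])
      (simp add: symmetric_op_iff_adjoint_pair)
  also have "(sech_CB t o\<^sub>L hyp 1 t (C o\<^sub>L B)) o\<^sub>L C = (sech_CB t o\<^sub>L C) o\<^sub>L sinhc_BC t"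
    by (simp only: op_comp_assoc C_hyp)
  also have "\<dots> = C o\<^sub>L tanhc_BC t"
    by (simp only: C_sech[OF t, symmetric] hyp_sech[OF t] op_comp_assoc)
  finally show ?thesis by (simp add: symmetric_op_iff_adjoint_pair)
qed

text \<open>
  This rewrites \<open>C Q = C f(BC) B\<close> as \<open>f(CB) (CB)\<close>, the shape in which the logarithmic derivative of the
  determinant of \<open>cosh(t \<surd>(CB))\<close> appears.
\<close>

lemma C_tanhc:
  assumes t: "t \<ge> 0"
  shows "C o\<^sub>L tanhc_BC t = (hyp 1 t (C o\<^sub>L B) o\<^sub>L sech_CB t) o\<^sub>L C"
proof -
  have "C o\<^sub>L tanhc_BC t = (C o\<^sub>L sinhc_BC t) o\<^sub>L sech_BC t" by (simp only: op_comp_assoc)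
  also have "\<dots> = hyp 1 t (C o\<^sub>L B) o\<^sub>L (C o\<^sub>L sech_BC t)" by (simp only: C_hyp op_comp_assoc)
  finally show ?thesis by (simp only: C_sech[OF t] op_comp_assoc)
qed

end

section \<open>The trace and the logarithm of the determinant\<close>

context
  fixes B C :: "'a operator" and a b :: "nat \<Rightarrow> 'a"
  assumes lin: "linear_over K scl B" "linear_over K scl C"
    and B: "symmetric_op ip B" "nonneg_op ip B"
    and C: "symmetric_op ip C" "nonneg_op ip C"
    and nuc: "nuclear_rep a b B"
begin

abbreviation (input) "trace_CQ_value t \<equiv> nuclear_trace a (\<lambda>n. C (b n)) (tanhc_BC C B t)"

lemma linear_over_tanhc:
  assumes t: "t \<ge> 0"
  shows "linear_over K scl (inverse_op (hyp 0 t (B o\<^sub>L C)))" "linear_over K scl (tanhc_BC B C t)"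
proof -
  have BC: "linear_over K scl (B o\<^sub>L C)" by (intro linear_over_comp lin)
  show W: "linear_over K scl (inverse_op (hyp 0 t (B o\<^sub>L C)))"
    by (rule linear_over_inverse_pair[OF linear_over_hyp[OF BC] sech_BC_inverse[OF B C t]])
  show "linear_over K scl (tanhc_BC B C t)"
    by (intro linear_over_comp W linear_over_hyp[OF BC])
qed

lemma nuclear_rep_CQ:
  assumes t: "t \<ge> 0"
  shows "nuclear_rep a (\<lambda>n. (C o\<^sub>L tanhc_BC B C t) (b n)) (C o\<^sub>L (tanhc_BC B C t o\<^sub>L B))"
  using nuclear_rep_comp_left[OF nuc linear_over_comp[OF lin(2) linear_over_tanhc(2)[OF t]]]
  by (simp only: op_comp_assoc)

lemma trace_CQ:
  assumes t: "t \<ge> 0"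
  shows "trace_op ip (C o\<^sub>L (tanhc_BC B C t o\<^sub>L B)) = trace_CQ_value t"
proof -
  have "(C o\<^sub>L tanhc_BC B C t) x = tanhc_BC C B t (C x)" for x
    using arg_cong[OF C_tanhc[OF B C t], of "\<lambda>T. T x"] by simp
  then show ?thesis
    unfolding trace_op_eq[OF nuclear_rep_CQ[OF t]] nuclear_trace_def by simp
qed

text \<open>
  Conjugation passes from \<open>C f B\<close> to its adjoint \<open>B C f\<close>, and both have trace \<open>\<Sum> \<langle>a\<^sub>n, C f b\<^sub>n\<rangle>\<close> since \<open>C f\<close> is
  symmetric.
\<close>

lemma trace_CQ_real:
  assumes t: "t \<ge> 0"
  shows "trace_CQ_value t = complex_of_real (Re (trace_CQ_value t))"
proof -
  have Cf: "symmetric_op ip (C o\<^sub>L tanhc_BC B C t)" by (rule symmetric_C_tanhc[OF B C t])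
  note rep = nuclear_rep_comp_symmetric[OF nuc Cf]
  have "adjoint_pair ip ((C o\<^sub>L tanhc_BC B C t) o\<^sub>L B) (B o\<^sub>L (C o\<^sub>L tanhc_BC B C t))"
    by (rule adjoint_pair_comp) (use Cf B(1) in \<open>simp_all add: symmetric_op_iff_adjoint_pair\<close>)
  then have "cnj (trace_op ip (C o\<^sub>L (tanhc_BC B C t o\<^sub>L B))) = trace_op ip (B o\<^sub>L (C o\<^sub>L tanhc_BC B C t))"
    by (intro trace_op_cnj[OF nuclear_rep_CQ[OF t] rep]) (simp only: op_comp_assoc)
  also have "\<dots> = trace_op ip (C o\<^sub>L (tanhc_BC B C t o\<^sub>L B))"
    unfolding trace_op_eq[OF rep] trace_op_eq[OF nuclear_rep_CQ[OF t]] nuclear_trace_def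
    using Cf by (simp add: symmetric_op_def)
  finally have "cnj (trace_CQ_value t) = trace_CQ_value t" by (simp only: trace_CQ[OF t])
  then show ?thesis by (metis Reals_cnj_iff of_real_Re)
qed

lemma linear_over_CB: "linear_over K scl (C o\<^sub>L B)"
  by (intro linear_over_comp lin)

lemma nuclear_rep_CB: "nuclear_rep a (\<lambda>n. C (b n)) (C o\<^sub>L B)"
  by (rule nuclear_rep_comp_left[OF nuc lin(2)])

lemma continuous_on_tanhc_CB: "continuous_on {0..} (tanhc_BC C B)"
  using tanhc_derivative[OF C B]
  by (auto simp: continuous_on_eq_continuous_within intro: has_vector_derivative_continuous)

lemma continuous_on_trace: "continuous_on {0..} trace_CQ_value"
  by (rule bounded_linear.continuous_on[OF
        bounded_linear_nuclear_trace(3)[OF nuclear_rep_summable[OF nuclear_rep_CB]] continuous_on_tanhc_CB])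

lemma continuous_on_trace_CQ: "continuous_on {0..} (\<lambda>t. trace_op ip (C o\<^sub>L (tanhc_BC B C t o\<^sub>L B)))"
  by (rule continuous_on_eq[OF continuous_on_trace]) (simp only: trace_CQ atLeast_iff)

definition log_det :: "real \<Rightarrow> real"
  where "log_det t = integral {0..t} (\<lambda>u. Re (trace_CQ_value u))"

lemma log_det_derivative_interval:
  assumes t: "t \<in> {0..T}"
  shows "((\<lambda>t. complex_of_real (log_det t)) has_vector_derivative trace_CQ_value t) (at t within {0..T})"
proof -
  have "continuous_on {0..T} (\<lambda>u. Re (trace_CQ_value u))"
    by (intro continuous_on_Re continuous_on_subset[OF continuous_on_trace]) auto
  from integral_has_vector_derivative[OF this t]
  have "(log_det has_vector_derivative Re (trace_CQ_value t)) (at t within {0..T})"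
    by (simp add: log_det_def[abs_def])
  from bounded_linear.has_vector_derivative[OF bounded_linear_of_real[where 'a=complex] this]
  show ?thesis using trace_CQ_real[of t] t by simp
qed

lemma det_cosh:
  assumes t: "t \<ge> 0"
  shows "det_op ip (hyp 0 t (C o\<^sub>L B)) = complex_of_real (exp (log_det t))"
proof -
  let ?V = "\<lambda>t. inverse_op (hyp 0 t (C o\<^sub>L B))"
  have "continuous_on {0..} ?V"
    using sech_derivative[OF C B]
    by (auto simp: continuous_on_eq_continuous_within intro: has_vector_derivative_continuous)
  then have "continuous_on {0..t} ?V" by (rule continuous_on_subset) auto
  then obtain \<kappa> where \<kappa>: "0 \<le> \<kappa>" "\<And>u. u \<in> {0..t} \<Longrightarrow> norm (?V u) \<le> \<kappa>"
    by (rule continuous_on_interval_bounded) blast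
  obtain \<eta>1 where \<eta>1: "0 \<le> \<eta>1" "\<And>u. u \<in> {0..t} \<Longrightarrow> norm (hyp 1 u (C o\<^sub>L B)) \<le> \<eta>1"
    by (rule continuous_on_interval_bounded[OF continuous_on_hyp]) blast
  obtain \<eta>2 where \<eta>2: "0 \<le> \<eta>2" "\<And>u. u \<in> {0..t} \<Longrightarrow> norm (hyp 2 u (C o\<^sub>L B)) \<le> \<eta>2"
    by (rule continuous_on_interval_bounded[OF continuous_on_hyp]) blast
  have "det_op ip (hyp 0 t (C o\<^sub>L B)) = exp (complex_of_real (log_det t))"
  proof (rule det_op_hyp_0[OF linear_over_CB nuclear_rep_CB, where T=t and W="?V" and \<kappa>=\<kappa> and \<eta>="max \<eta>1 \<eta>2"
        and \<gamma>="\<lambda>t. complex_of_real (log_det t)"])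
    fix u assume u: "u \<in> {0..t}"
    show "inverse_pair (hyp 0 u (C o\<^sub>L B)) (?V u)" using u by (intro sech_BC_inverse[OF C B]) simp
    show "norm (?V u) \<le> \<kappa>" by (rule \<kappa>(2)[OF u])
    show "norm (hyp 1 u (C o\<^sub>L B)) \<le> max \<eta>1 \<eta>2" using \<eta>1(2)[OF u] by linarith
    show "norm (hyp 2 u (C o\<^sub>L B)) \<le> max \<eta>1 \<eta>2" using \<eta>2(2)[OF u] by linarith
    show "((\<lambda>t. complex_of_real (log_det t)) has_vector_derivative trace_CQ_value u) (at u within {0..t})"
      by (rule log_det_derivative_interval[OF u])
  qed (use \<kappa>(1) \<eta>1(1) t in \<open>auto simp: log_det_def\<close>)
  then show ?thesis by (simp add: exp_of_real)
qed

lemma log_det_derivative: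
  assumes t: "t \<ge> 0"
  shows "((\<lambda>t. complex_of_real (log_det t)) has_vector_derivative trace_CQ_value t) (at t within {0..})"
  using t by (intro has_vector_derivative_within_ray log_det_derivative_interval) auto

lemma det_cosh_powr:
  assumes t: "t \<ge> 0"
  shows "det_op ip (hyp 0 t (C o\<^sub>L B)) powr (- (1/2)) = exp (- (complex_of_real (log_det t) / 2))"
  using det_cosh[OF t] by (simp add: powr_def Ln_of_real)

lemma s_derivative:
  assumes t: "t \<ge> 0"
  shows "((\<lambda>t. exp (\<alpha> * of_real t) * exp (- (complex_of_real (log_det t) / 2))) has_vector_derivative
    - (1/2) * (exp (\<alpha> * of_real t) * exp (- (complex_of_real (log_det t) / 2))) * trace_CQ_value t
    + \<alpha> * (exp (\<alpha> * of_real t) * exp (- (complex_of_real (log_det t) / 2)))) (at t within {0..})"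
proof -
  let ?e = "\<lambda>t. \<alpha> * complex_of_real t - (1/2) * complex_of_real (log_det t)"
  have "((\<lambda>t. complex_of_real t) has_vector_derivative 1) (at t within {0..})"
    using bounded_linear.has_vector_derivative[OF bounded_linear_of_real[where 'a=complex] has_vector_derivative_id] by simp
  then have "(?e has_vector_derivative \<alpha> * 1 - (1/2) * trace_CQ_value t) (at t within {0..})"
    by (intro has_vector_derivative_diff has_vector_derivative_mult_right log_det_derivative t)
  then have "((exp \<circ> ?e) has_vector_derivative (\<alpha> * 1 - (1/2) * trace_CQ_value t) * exp (?e t)) (at t within {0..})"
    by (rule field_vector_diff_chain_within[OF _ has_field_derivative_at_within[OF DERIV_exp]])
  moreover have "exp \<circ> ?e = (\<lambda>t. exp (\<alpha> * of_real t) * exp (- (complex_of_real (log_det t) / 2)))"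
    by (simp add: fun_eq_iff flip: exp_add)
  moreover have "exp (?e t) = exp (\<alpha> * of_real t) * exp (- (complex_of_real (log_det t) / 2))"
    by (simp flip: exp_add)
  ultimately show ?thesis by (simp add: algebra_simps)
qed

lemma cosh_minus_id_nuclear: "nuclear_op scl ip (hyp 0 t (C o\<^sub>L B) - id_blinfun)"
proof -
  have "hyp 0 t (C o\<^sub>L B) - id_blinfun = hyp 2 t (C o\<^sub>L B) o\<^sub>L (C o\<^sub>L B)"
    by (simp add: hyp_0_eq hyp_commute)
  then show ?thesis
    using nuclear_rep_comp_left[OF nuclear_rep_CB linear_over_hyp[OF linear_over_CB]]
    by (auto simp: nuclear_op_iff)
qed

lemma hyperbolic_functions_solve_system:
  "solves_system K scl ip \<alpha> B C 0
    (\<lambda>t. exp (\<alpha> * of_real t) * exp (- (complex_of_real (log_det t) / 2)))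
    (\<lambda>t. C o\<^sub>L tanhc_BC B C t) (\<lambda>t. tanhc_BC B C t o\<^sub>L B) (\<lambda>t. inverse_op (hyp 0 t (B o\<^sub>L C)))"
  unfolding solves_system_def
proof (intro conjI allI impI)
  fix t :: real assume t: "0 \<le> t"
  show "linear_over K scl (C o\<^sub>L tanhc_BC B C t)" "linear_over K scl (tanhc_BC B C t o\<^sub>L B)"
    "linear_over K scl (inverse_op (hyp 0 t (B o\<^sub>L C)))"
    by (intro linear_over_comp lin linear_over_tanhc t)+
  show "nuclear_op scl ip (C o\<^sub>L (tanhc_BC B C t o\<^sub>L B))"
    using nuclear_rep_CQ[OF t] by (auto simp: nuclear_op_iff)
  show "((\<lambda>t. exp (\<alpha> * of_real t) * exp (- (complex_of_real (log_det t) / 2))) has_vector_derivative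
    - (1/2) * (exp (\<alpha> * of_real t) * exp (- (complex_of_real (log_det t) / 2))) *
      trace_op ip (C o\<^sub>L (tanhc_BC B C t o\<^sub>L B))
    + \<alpha> * (exp (\<alpha> * of_real t) * exp (- (complex_of_real (log_det t) / 2)))) (at t within {0..})"
    unfolding trace_CQ[OF t] by (rule s_derivative[OF t])
  show "((\<lambda>t. C o\<^sub>L tanhc_BC B C t) has_vector_derivative
      adjoint_op ip (inverse_op (hyp 0 t (B o\<^sub>L C))) o\<^sub>L C o\<^sub>L inverse_op (hyp 0 t (B o\<^sub>L C)))
      (at t within {0..})"
    by (rule P_derivative[OF B C t])
  show "((\<lambda>t. tanhc_BC B C t o\<^sub>L B) has_vector_derivative
      B - ((tanhc_BC B C t o\<^sub>L B) o\<^sub>L C o\<^sub>L (tanhc_BC B C t o\<^sub>L B)) + (adjoint_op ip 0 o\<^sub>L (tanhc_BC B C t o\<^sub>L B))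
        + ((tanhc_BC B C t o\<^sub>L B) o\<^sub>L 0)) (at t within {0..})"
    using Q_derivative[OF B C t] by (simp add: adjoint_op_0)
  show "((\<lambda>t. inverse_op (hyp 0 t (B o\<^sub>L C))) has_vector_derivative
      - ((tanhc_BC B C t o\<^sub>L B) o\<^sub>L C o\<^sub>L inverse_op (hyp 0 t (B o\<^sub>L C)))
        + (adjoint_op ip 0 o\<^sub>L inverse_op (hyp 0 t (B o\<^sub>L C)))) (at t within {0..})"
    using R_derivative[OF B C t] by (simp add: adjoint_op_0)
qed (simp_all add: log_det_def hyp_at_0 inverse_op_id)

end

section \<open>Uniqueness of the solution\<close>

text \<open>
  The equation of \<open>Q\<close> does not involve the other functions; once \<open>Q\<close> is determined, those of \<open>R\<close> and
  \<open>s\<close> are linear, and \<open>P\<close> is an integral.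
\<close>

lemma solves_system_unique:
  assumes 1: "solves_system K scl ip \<alpha> B C 0 s P Q R"
    and 2: "solves_system K scl ip \<alpha> B C 0 s' P' Q' R'"
    and tr: "continuous_on {0..} (\<lambda>t. trace_op ip (C o\<^sub>L Q' t))"
    and t: "t \<ge> 0"
  shows "s t = s' t" "P t = P' t" "Q t = Q' t" "R t = R' t"
proof -
  have init: "s 0 = s' 0" "P 0 = P' 0" "Q 0 = Q' 0" "R 0 = R' 0"
    using 1 2 by (simp_all add: solves_system_def)
  have Q_derivs: "(Q has_vector_derivative B - (Q u o\<^sub>L C o\<^sub>L Q u)) (at u within {0..})"
      "(Q' has_vector_derivative B - (Q' u o\<^sub>L C o\<^sub>L Q' u)) (at u within {0..})" if "u \<ge> 0" for u
    using 1 2 that by (simp_all add: solves_system_def adjoint_op_0)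
  have contQ: "continuous_on {0..} Q" "continuous_on {0..} Q'"
    using Q_derivs
    by (auto simp: continuous_on_eq_continuous_within intro: has_vector_derivative_continuous)
  have Q: "Q u = Q' u" if "u \<ge> 0" for u
  proof (rule ode_unique[OF Q_derivs _ _ init(3) that])
    show "continuous_on {0..} (\<lambda>u. norm (Q u) * norm C + norm C * norm (Q' u))"
      by (intro continuous_intros contQ)
    fix u :: real
    have "(B - (Q u o\<^sub>L C o\<^sub>L Q u)) - (B - (Q' u o\<^sub>L C o\<^sub>L Q' u))
        = - (((Q u o\<^sub>L C) o\<^sub>L (Q u - Q' u)) + ((Q u - Q' u) o\<^sub>L (C o\<^sub>L Q' u)))"
      by (simp add: op_comp.diff_left op_comp.diff_right op_comp_assoc)
    also have "norm \<dots> \<le> norm ((Q u o\<^sub>L C) o\<^sub>L (Q u - Q' u)) + norm ((Q u - Q' u) o\<^sub>L (C o\<^sub>L Q' u))"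
      unfolding norm_minus_cancel by (rule norm_triangle_ineq)
    also have "\<dots> \<le> (norm (Q u) * norm C) * norm (Q u - Q' u) + norm (Q u - Q' u) * (norm C * norm (Q' u))"
      by (intro add_mono order_trans[OF norm_blinfun_compose] mult_left_mono mult_right_mono
          norm_blinfun_compose norm_ge_zero)
    finally show "norm ((B - (Q u o\<^sub>L C o\<^sub>L Q u)) - (B - (Q' u o\<^sub>L C o\<^sub>L Q' u)))
        \<le> (norm (Q u) * norm C + norm C * norm (Q' u)) * norm (Q u - Q' u)"
      by (simp add: algebra_simps)
  qed
  have R_derivs: "(R has_vector_derivative - (Q' u o\<^sub>L C o\<^sub>L R u)) (at u within {0..})"
      "(R' has_vector_derivative - (Q' u o\<^sub>L C o\<^sub>L R' u)) (at u within {0..})" if "u \<ge> 0" for u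
    using 1 2 that by (simp_all add: solves_system_def adjoint_op_0 flip: Q)
  have R: "R u = R' u" if "u \<ge> 0" for u
  proof (rule ode_unique[OF R_derivs _ _ init(4) that])
    show "continuous_on {0..} (\<lambda>u. norm (Q' u o\<^sub>L C))"
      by (intro continuous_on_norm bounded_linear.continuous_on[OF op_comp.bounded_linear_left] contQ)
    fix u :: real
    have "- (Q' u o\<^sub>L C o\<^sub>L R u) - - (Q' u o\<^sub>L C o\<^sub>L R' u) = - ((Q' u o\<^sub>L C) o\<^sub>L (R u - R' u))"
      by (simp add: op_comp.diff_right)
    then show "norm (- (Q' u o\<^sub>L C o\<^sub>L R u) - - (Q' u o\<^sub>L C o\<^sub>L R' u)) \<le> norm (Q' u o\<^sub>L C) * norm (R u - R' u)"
      by (simp only: norm_minus_cancel norm_blinfun_compose)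
  qed
  have P_derivs: "(P has_vector_derivative adjoint_op ip (R' u) o\<^sub>L C o\<^sub>L R' u) (at u within {0..})"
      "(P' has_vector_derivative adjoint_op ip (R' u) o\<^sub>L C o\<^sub>L R' u) (at u within {0..})" if "u \<ge> 0" for u
    using 1 2 that by (simp_all add: solves_system_def flip: R)
  have P: "P u = P' u" if "u \<ge> 0" for u
    by (rule ode_unique[OF P_derivs _ _ init(2) that, where L="\<lambda>_. 0"]) auto
  have s_derivs: "(s has_vector_derivative - (1/2) * s u * trace_op ip (C o\<^sub>L Q' u) + \<alpha> * s u) (at u within {0..})"
      "(s' has_vector_derivative - (1/2) * s' u * trace_op ip (C o\<^sub>L Q' u) + \<alpha> * s' u) (at u within {0..})"
      if "u \<ge> 0" for u
    using 1 2 that by (simp_all add: solves_system_def flip: Q)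
  have s: "s u = s' u" if "u \<ge> 0" for u
  proof (rule ode_unique[OF s_derivs _ _ init(1) that])
    show "continuous_on {0..} (\<lambda>u. norm (- (1/2) * trace_op ip (C o\<^sub>L Q' u) + \<alpha>))"
      by (intro continuous_intros tr)
    fix u :: real
    have "(- (1/2) * s u * trace_op ip (C o\<^sub>L Q' u) + \<alpha> * s u) - (- (1/2) * s' u * trace_op ip (C o\<^sub>L Q' u) + \<alpha> * s' u)
        = (- (1/2) * trace_op ip (C o\<^sub>L Q' u) + \<alpha>) * (s u - s' u)"
      by (simp add: field_simps)
    then show "norm ((- (1/2) * s u * trace_op ip (C o\<^sub>L Q' u) + \<alpha> * s u) - (- (1/2) * s' u * trace_op ip (C o\<^sub>L Q' u) + \<alpha> * s' u))
        \<le> norm (- (1/2) * trace_op ip (C o\<^sub>L Q' u) + \<alpha>) * norm (s u - s' u)"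
      by (simp only: norm_mult order_refl)
  qed
  show "s t = s' t" "P t = P' t" "Q t = Q' t" "R t = R' t"
    by (fact s[OF t] P[OF t] Q[OF t] R[OF t])+
qed

end

lemma solves_system_cong:
  assumes sol: "solves_system K scl ip \<alpha> B C D s P Q R"
    and eq: "\<And>t. t \<ge> 0 \<Longrightarrow> s' t = s t" "\<And>t. t \<ge> 0 \<Longrightarrow> P' t = P t"
      "\<And>t. t \<ge> 0 \<Longrightarrow> Q' t = Q t" "\<And>t. t \<ge> 0 \<Longrightarrow> R' t = R t"
  shows "solves_system K scl ip \<alpha> B C D s' P' Q' R'"
  using sol unfolding solves_system_def
  by (simp add: eq has_vector_derivative_ray_cong[OF eq(1)] has_vector_derivative_ray_cong[OF eq(2)]
      has_vector_derivative_ray_cong[OF eq(3)] has_vector_derivative_ray_cong[OF eq(4)])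

theorem theorem4:
  fixes K :: "complex set"
    and scl :: "complex \<Rightarrow> 'a::{banach, second_countable_topology} \<Rightarrow> 'a"
    and ip :: "'a \<Rightarrow> 'a \<Rightarrow> complex"
    and \<alpha> :: complex
    and B C D :: "'a operator"
    and s :: "real \<Rightarrow> complex"
    and P Q R :: "real \<Rightarrow> 'a operator"
  assumes "hilbert_space K scl ip"
    and "linear_over K scl B" and "linear_over K scl C" and "linear_over K scl D"
    and "symmetric_op ip B" and "nonneg_op ip B"
    and "symmetric_op ip C" and "nonneg_op ip C"
    and "nuclear_op scl ip B"
    and "D = 0"
  shows
    "(\<forall>t\<ge>0. invertible_op (cosh_sqrt t (B o\<^sub>L C)) \<and>
            nuclear_op scl ip (cosh_sqrt t (C o\<^sub>L B) - id_blinfun) \<and>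
            (\<exists>d>0. det_op ip (cosh_sqrt t (C o\<^sub>L B)) = complex_of_real d)) \<and>
     (solves_system K scl ip \<alpha> B C D s P Q R \<longleftrightarrow>
       (\<forall>t\<ge>0.
          s t = exp (\<alpha> * of_real t) * det_op ip (cosh_sqrt t (C o\<^sub>L B)) powr (- (1/2)) \<and>
          P t = C o\<^sub>L tanh_sqrt_div_sqrt t (B o\<^sub>L C) \<and>
          Q t = tanh_sqrt_div_sqrt t (B o\<^sub>L C) o\<^sub>L B \<and>
          R t = inverse_op (cosh_sqrt t (B o\<^sub>L C))))"
proof -
  interpret hilbert_space K scl ip by fact
  obtain a b where nuc: "nuclear_rep a b B"
    using assms(9) by (auto simp: nuclear_op_iff)
  note hyps = assms(2,3,5,6,7,8) nuc
  note BC = assms(5-8)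
  let ?tanhc = "\<lambda>t. tanh_sqrt_div_sqrt t (B o\<^sub>L C)"
  have tanhc: "?tanhc t = hyp 1 t (B o\<^sub>L C) o\<^sub>L inverse_op (hyp 0 t (B o\<^sub>L C))" for t
    by (simp add: tanh_sqrt_div_sqrt_def cosh_sqrt_eq_hyp sinh_sqrt_div_sqrt_eq_hyp)
  have det: "det_op ip (cosh_sqrt t (C o\<^sub>L B)) = complex_of_real (exp (log_det B C a b t))" if "t \<ge> 0" for t
    unfolding cosh_sqrt_eq_hyp by (rule det_cosh[OF hyps that])
  let ?s = "\<lambda>t. exp (\<alpha> * of_real t) * exp (- (complex_of_real (log_det B C a b t) / 2))"
  note s = det_cosh_powr[OF hyps, folded cosh_sqrt_eq_hyp]
  note sol = hyperbolic_functions_solve_system[OF hyps, of \<alpha>]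
  have tr: "continuous_on {0..} (\<lambda>t. trace_op ip (C o\<^sub>L (?tanhc t o\<^sub>L B)))"
    unfolding tanhc by (rule continuous_on_trace_CQ[OF hyps])
  show ?thesis
  proof (intro conjI allI impI iffI)
    fix t :: real assume t: "0 \<le> t"
    show "invertible_op (cosh_sqrt t (B o\<^sub>L C))"
      using sech_BC_inverse[OF BC t] by (auto simp: invertible_op_def inverse_pair_def cosh_sqrt_eq_hyp)
    show "nuclear_op scl ip (cosh_sqrt t (C o\<^sub>L B) - id_blinfun)"
      unfolding cosh_sqrt_eq_hyp by (rule cosh_minus_id_nuclear[OF hyps])
    show "\<exists>d>0. det_op ip (cosh_sqrt t (C o\<^sub>L B)) = complex_of_real d"
      using det[OF t] exp_gt_zero by blast
  next
    fix t :: real assume t: "0 \<le> t"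
    assume "solves_system K scl ip \<alpha> B C D s P Q R"
    then have "solves_system K scl ip \<alpha> B C 0 s P Q R" by (simp only: assms(10))
    note eq = solves_system_unique[OF this sol[folded tanhc] tr t]
    show "s t = exp (\<alpha> * of_real t) * det_op ip (cosh_sqrt t (C o\<^sub>L B)) powr (- (1/2))"
      using eq(1) s[OF t] by simp
    show "P t = C o\<^sub>L ?tanhc t" "Q t = ?tanhc t o\<^sub>L B" "R t = inverse_op (cosh_sqrt t (B o\<^sub>L C))"
      using eq(2-4) by (simp_all add: cosh_sqrt_eq_hyp)
  next
    assume "\<forall>t\<ge>0.
          s t = exp (\<alpha> * of_real t) * det_op ip (cosh_sqrt t (C o\<^sub>L B)) powr (- (1/2)) \<and>
          P t = C o\<^sub>L ?tanhc t \<and> Q t = ?tanhc t o\<^sub>L B \<and> R t = inverse_op (cosh_sqrt t (B o\<^sub>L C))"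
    then show "solves_system K scl ip \<alpha> B C D s P Q R"
      unfolding assms(10) using s
      by (intro solves_system_cong[OF sol[folded tanhc]]) (simp_all add: cosh_sqrt_eq_hyp)
  qed
qed

end
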